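(* Let $n\ge 2$, let $\Omega\subset\mathbb{R}^n$ be a domain (a nonempty connected open set), and let $G:\mathbb{R}\to\mathbb{R}$ be a smooth function. Let $u:\Omega\to\mathbb{R}$ be a smooth convex solution of $\Delta u=G(u)$ in $\Omega$, and suppose that $G>0$, $G'<0$ and $G\,G''\le \frac{n}{n-1}(G')^2$ in $\Omega$, i.e. these inequalities hold at $t=u(x)$ for every $x\in\Omega$. If the function $x\mapsto\det(D^2u(x))$ has a local minimum at some point of $\Omega$, then $\det(D^2u)=0$ everywhere in $\Omega$.
   Context: $D^2u$ denotes the Hessian matrix of $u$, and $\Delta u$ its trace. $G'$ and $G''$ denote the first and second derivatives of the one-variable function $G$. Convexity of $u$ on $\Omega$ (which need not be a convex set) means that $D^2u(x)$ is positive semidefinite for every $x\in\Omega$. A local minimum is not assumed to be strict. *)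

theory Defs
  imports "HOL-Analysis.Analysis"
begin

(* Meant for open S.  In finite dimension, asking for all directional derivatives
   is the usual definition of C^k by continuity of the partial derivatives. *)
primrec Ck_on :: "nat \<Rightarrow> 'a::real_normed_vector set \<Rightarrow> ('a \<Rightarrow> 'b::real_normed_vector) \<Rightarrow> bool" where
  "Ck_on 0 S f \<longleftrightarrow> continuous_on S f"
| "Ck_on (Suc k) S f \<longleftrightarrow>
     (\<forall>x\<in>S. f differentiable (at x)) \<and>
     (\<forall>v. Ck_on k S (\<lambda>x. frechet_derivative f (at x) v))"

definition smooth_on :: "'a::real_normed_vector set \<Rightarrow> ('a \<Rightarrow> 'b::real_normed_vector) \<Rightarrow> bool" where
  "smooth_on S f \<longleftrightarrow> (\<forall>k. Ck_on k S f)"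

definition partial_deriv :: "'n \<Rightarrow> (real ^ 'n \<Rightarrow> real) \<Rightarrow> real ^ 'n \<Rightarrow> real" where
  "partial_deriv i f x = frechet_derivative f (at x) (axis i 1)"

definition hessian :: "(real ^ 'n \<Rightarrow> real) \<Rightarrow> real ^ 'n \<Rightarrow> real ^ 'n ^ 'n" where
  "hessian f x = (\<chi> i j. partial_deriv i (partial_deriv j f) x)"

definition laplacian :: "(real ^ 'n \<Rightarrow> real) \<Rightarrow> real ^ 'n \<Rightarrow> real" where
  "laplacian f x = trace (hessian f x)"

(* Symmetry is not part of the definition: the Hessian of a smooth function is symmetric. *)
definition pos_semidef :: "real ^ 'n ^ 'n \<Rightarrow> bool" where
  "pos_semidef A \<longleftrightarrow> (\<forall>v. 0 \<le> v \<bullet> (A *v v))"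

(* Infinitesimal convexity: S need not be a convex set. *)
definition hessian_convex_on :: "(real ^ 'n) set \<Rightarrow> (real ^ 'n \<Rightarrow> real) \<Rightarrow> bool" where
  "hessian_convex_on S f \<longleftrightarrow> (\<forall>x\<in>S. pos_semidef (hessian f x))"

(* Not necessarily strict. *)
definition local_min_at :: "'a::topological_space set \<Rightarrow> ('a \<Rightarrow> real) \<Rightarrow> 'a \<Rightarrow> bool" where
  "local_min_at S f p \<longleftrightarrow> p \<in> S \<and> (\<forall>\<^sub>F x in at p within S. f p \<le> f x)"

end

theory Submission
  imports Defs
begin

text \<open>
Write \<open>W = D\<^sup>2u\<close>, a positive semidefinite matrix field, and index derivatives of \<open>u\<close> by directions. Both
halves of the argument live on the equation differentiated once and twice in a fixed direction
\<open>v\<close>, namely \<open>\<Delta>(u\<^sub>v) = G'(u) u\<^sub>v\<close> and \<open>\<Delta>(W(v,v)) = G''(u) u\<^sub>v\<^sup>2 + G'(u) W(v,v)\<close>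
(\<open>semilinear_differentiated\<close>). They differ according to whether \<open>det W\<close> vanishes at the local minimum.

If \<open>det W(p) > 0\<close> at a local minimum \<open>p\<close>, then \<open>ln det W\<close> has a local minimum there as well. In an orthonormal
eigenbasis of \<open>W(p)\<close> with eigenvalues \<open>l\<^sub>i\<close> this says \<open>\<Sum>\<^sub>i u\<^sub>i\<^sub>i\<^sub>k / l\<^sub>i = 0\<close> for every \<open>k\<close> and
\<open>0 \<le> \<Delta>(ln det W) = n G' + G'' \<Sum>\<^sub>k u\<^sub>k\<^sup>2 / l\<^sub>k - \<Sum>\<^sub>i\<^sub>j\<^sub>k u\<^sub>i\<^sub>j\<^sub>k\<^sup>2 / (l\<^sub>i l\<^sub>j)\<close>.
Since \<open>\<Sum>\<^sub>i u\<^sub>i\<^sub>i\<^sub>k = G' u\<^sub>k\<close> and \<open>\<Sum>\<^sub>i l\<^sub>i = G\<close>, the algebraic inequality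
\<open>symmetric_tensor_trace_inequality\<close> bounds the last sum from below by
\<open>n/(n-1) (G'\<^sup>2/G) \<Sum>\<^sub>k u\<^sub>k\<^sup>2 / l\<^sub>k\<close>, which is at least \<open>G'' \<Sum>\<^sub>k u\<^sub>k\<^sup>2 / l\<^sub>k\<close> by the hypothesis
on \<open>G\<close>. What remains is \<open>0 \<le> n G' < 0\<close>. So a local minimum is degenerate (\<open>no_nondegenerate_local_min\<close>).

If \<open>det W\<close> vanishes at a point, it vanishes everywhere (\<open>degenerate_set_propagates\<close>), by a strong minimum
principle for the lowest eigenvalue of \<open>W\<close>, which is only a continuous function. Suppose a smooth \<open>\<psi>\<close> touches
it from below at \<open>y\<close>, with unit eigenvector \<open>e\<close>. For any \<open>\<tau>\<close> the functions
\<open>t \<mapsto> (W - \<psi>)(y + t e\<^sub>k)(e + t \<tau> e\<^sub>k, e + t \<tau> e\<^sub>k)\<close> have a local minimum at \<open>t = 0\<close>. Adding their second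
derivatives over \<open>k\<close> brings in only the Laplacians above and the trace \<open>\<Sum>\<^sub>k u\<^sub>e\<^sub>k\<^sub>k = G' u\<^sub>e\<close>. The choice
\<open>\<tau> = - G' u\<^sub>e / G\<close> completes the square, and with \<open>G G'' \<le> 2 G'\<^sup>2\<close> (as \<open>n/(n-1) \<le> 2\<close>) one obtains
\<open>\<Delta>\<psi> \<le> C |\<nabla>\<psi>|\<close> (\<open>lowest_eigenvalue_supersolution\<close>). A Gaussian barrier, as in the Hopf boundary lemma,
violates this inequality, so the zero set of \<open>det W\<close> has no boundary point in the connected set \<open>\<Omega>\<close>.
\<close>

section \<open>Directional derivatives of smooth functions\<close>

text \<open>
The direction comes first so that \<open>dderiv v f\<close> is again a function and iterated derivatives read
\<open>dderiv a (dderiv b f)\<close>.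
\<close>

definition dderiv :: "'a::real_normed_vector \<Rightarrow> ('a \<Rightarrow> real) \<Rightarrow> 'a \<Rightarrow> real" where
  "dderiv v f = (\<lambda>x. frechet_derivative f (at x) v)"

lemma smooth_on_dderiv: "smooth_on S f \<Longrightarrow> smooth_on S (dderiv v f)"
  unfolding smooth_on_def dderiv_def by (metis Ck_on.simps(2))

lemma smooth_on_differentiable: "smooth_on S f \<Longrightarrow> x \<in> S \<Longrightarrow> f differentiable (at x)"
  unfolding smooth_on_def by (metis Ck_on.simps(2))

lemma smooth_on_continuous_on: "smooth_on S f \<Longrightarrow> continuous_on S f"
  unfolding smooth_on_def by (metis Ck_on.simps(1))

lemma smooth_on_has_derivative:
  assumes "smooth_on S f" "x \<in> S"
  shows "(f has_derivative (\<lambda>v. dderiv v f x)) (at x)"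
  using smooth_on_differentiable[OF assms] by (simp add: dderiv_def frechet_derivative_works)

lemma dderiv_eqI: "(f has_derivative f') (at x) \<Longrightarrow> dderiv v f x = f' v"
  using frechet_derivative_at[of f f' x] by (simp add: dderiv_def)

lemma dderiv_cong:
  assumes "open S" "x \<in> S" "smooth_on S f" "\<And>y. y \<in> S \<Longrightarrow> f y = g y"
  shows "dderiv v f x = dderiv v g x"
proof -
  have "(g has_derivative (\<lambda>v. dderiv v f x)) (at x)"
    using has_derivative_transform_within_open[OF smooth_on_has_derivative[OF assms(3,2)] assms(1,2)]
      assms(4) by blast
  then show ?thesis by (simp add: dderiv_eqI)
qed

lemma dderiv_line:
  assumes "smooth_on S f" "x + t *\<^sub>R q \<in> S"
  shows "((\<lambda>t. f (x + t *\<^sub>R q)) has_real_derivative dderiv q f (x + t *\<^sub>R q)) (at t)"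
proof -
  have "((\<lambda>t. x + t *\<^sub>R q) has_derivative (\<lambda>h. h *\<^sub>R q)) (at t)"
    by (auto intro!: derivative_eq_intros)
  then have "((f \<circ> (\<lambda>t. x + t *\<^sub>R q)) has_derivative
      ((\<lambda>v. dderiv v f (x + t *\<^sub>R q)) \<circ> (\<lambda>h. h *\<^sub>R q))) (at t)"
    by (rule diff_chain_at) (rule smooth_on_has_derivative[OF assms])
  moreover have "dderiv (h *\<^sub>R q) f (x + t *\<^sub>R q) = dderiv q f (x + t *\<^sub>R q) * h" for h
    using has_derivative_linear[OF smooth_on_has_derivative[OF assms]]
    by (simp add: linear_iff)
  ultimately show ?thesis
    by (simp add: has_field_derivative_def o_def)
qed

lemma dderiv_add_left:
  assumes "smooth_on S f" "x \<in> S"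
  shows "dderiv (v + w) f x = dderiv v f x + dderiv w f x"
  using has_derivative_linear[OF smooth_on_has_derivative[OF assms]] by (simp add: linear_iff)

lemma dderiv_scale_left:
  assumes "smooth_on S f" "x \<in> S"
  shows "dderiv (c *\<^sub>R v) f x = c * dderiv v f x"
  using has_derivative_linear[OF smooth_on_has_derivative[OF assms]] by (simp add: linear_iff)

lemma dderiv_sum_left:
  assumes "smooth_on S f" "x \<in> S"
  shows "dderiv (\<Sum>i\<in>I. c i *\<^sub>R v i) f x = (\<Sum>i\<in>I. c i * dderiv (v i) f x)"
  using linear_sum[OF has_derivative_linear[OF smooth_on_has_derivative[OF assms]], of "\<lambda>i. c i *\<^sub>R v i" I]
  by (simp add: dderiv_scale_left[OF assms])

text \<open>
Linearity in an inner direction is not a pointwise fact: it needs the identity of the preceding lemma on a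
neighbourhood, before the outer derivative is taken.
\<close>

lemma dderiv_dderiv_sum:
  assumes "open S" "smooth_on S f" "x \<in> S"
  shows "dderiv a (dderiv (\<Sum>i\<in>I. c i *\<^sub>R v i) f) x = (\<Sum>i\<in>I. c i * dderiv a (dderiv (v i) f) x)"
proof -
  have 1: "((\<lambda>y. \<Sum>i\<in>I. c i * dderiv (v i) f y) has_derivative
      (\<lambda>a. \<Sum>i\<in>I. c i * dderiv a (dderiv (v i) f) x)) (at x)"
    by (intro has_derivative_sum has_derivative_mult_right smooth_on_has_derivative[where S=S] smooth_on_dderiv assms)
  have "dderiv a (dderiv (\<Sum>i\<in>I. c i *\<^sub>R v i) f) x = dderiv a (\<lambda>y. \<Sum>i\<in>I. c i * dderiv (v i) f y) x"
    by (rule dderiv_cong[OF assms(1,3)]) (auto intro: smooth_on_dderiv assms simp: dderiv_sum_left[OF assms(2)])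
  then show ?thesis using dderiv_eqI[OF 1] by simp
qed

lemma dderiv_dderiv_add:
  assumes "open S" "smooth_on S f" "x \<in> S"
  shows "dderiv a (dderiv (v + w) f) x = dderiv a (dderiv v f) x + dderiv a (dderiv w f) x"
  using dderiv_dderiv_sum[OF assms, of a "\<lambda>_. 1" "\<lambda>b. if b then v else w" UNIV]
  by (simp add: UNIV_bool add.commute)

lemma dderiv_dderiv_scale:
  assumes "open S" "smooth_on S f" "x \<in> S"
  shows "dderiv a (dderiv (c *\<^sub>R v) f) x = c * dderiv a (dderiv v f) x"
  using dderiv_dderiv_sum[OF assms, of a "\<lambda>_. c" "\<lambda>_. v" "{()}"] by simp

lemma eventually_line_in_open:
  fixes x q :: "'a::real_normed_vector"
  assumes "open S" "x \<in> S"
  shows "\<forall>\<^sub>F t in nhds 0. x + t *\<^sub>R q \<in> S"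
proof -
  have "isCont (\<lambda>t. x + t *\<^sub>R q) 0"
    by (intro continuous_intros)
  then have "((\<lambda>t. x + t *\<^sub>R q) \<longlongrightarrow> x + 0 *\<^sub>R q) (nhds 0)"
    using tendsto_at_iff_tendsto_nhds[of "\<lambda>t. x + t *\<^sub>R q" 0] by (simp add: isCont_def)
  then show ?thesis using assms by (simp add: tendsto_def)
qed

text \<open>
The mean value theorem, applied first along \<open>a\<close> and then along \<open>b\<close>, turns the second difference over a
small parallelogram into a mixed derivative at an intermediate point. The left-hand side is symmetric in \<open>a\<close>
and \<open>b\<close>, which is what makes mixed derivatives commute.
\<close>

lemma second_difference_mvt:
  assumes "open S" "smooth_on S f" "0 < s"
    and in_S: "\<And>\<sigma> \<tau>. \<lbrakk>0 \<le> \<sigma>; \<sigma> \<le> s; 0 \<le> \<tau>; \<tau> \<le> s\<rbrakk> \<Longrightarrow> x + \<sigma> *\<^sub>R a + \<tau> *\<^sub>R b \<in> S"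
  obtains \<sigma> \<tau> where "0 \<le> \<sigma>" "\<sigma> \<le> s" "0 \<le> \<tau>" "\<tau> \<le> s"
    "f (x + s *\<^sub>R a + s *\<^sub>R b) - f (x + s *\<^sub>R a) - f (x + s *\<^sub>R b) + f x
      = s\<^sup>2 * dderiv b (dderiv a f) (x + \<sigma> *\<^sub>R a + \<tau> *\<^sub>R b)"
proof -
  let ?g = "\<lambda>\<sigma>. f ((x + s *\<^sub>R b) + \<sigma> *\<^sub>R a) - f (x + \<sigma> *\<^sub>R a)"
  let ?g' = "\<lambda>\<sigma>. dderiv a f ((x + s *\<^sub>R b) + \<sigma> *\<^sub>R a) - dderiv a f (x + \<sigma> *\<^sub>R a)"
  have "\<exists>\<sigma>. 0 < \<sigma> \<and> \<sigma> < s \<and> ?g s - ?g 0 = (s - 0) * ?g' \<sigma>"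
  proof (rule MVT2[OF \<open>0 < s\<close>])
    fix t assume t: "0 \<le> t" "t \<le> s"
    show "(?g has_real_derivative ?g' t) (at t)"
      by (intro DERIV_diff dderiv_line[OF assms(2)])
        (use in_S[OF t, of s] in_S[OF t, of 0] \<open>0 < s\<close> in \<open>simp_all add: algebra_simps\<close>)
  qed
  then obtain \<sigma> where \<sigma>: "0 < \<sigma>" "\<sigma> < s" "?g s - ?g 0 = s * ?g' \<sigma>" by auto
  let ?h = "\<lambda>\<tau>. dderiv a f ((x + \<sigma> *\<^sub>R a) + \<tau> *\<^sub>R b)"
  have "\<exists>\<tau>. 0 < \<tau> \<and> \<tau> < s \<and> ?h s - ?h 0 = (s - 0) * dderiv b (dderiv a f) ((x + \<sigma> *\<^sub>R a) + \<tau> *\<^sub>R b)"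
    by (rule MVT2[OF \<open>0 < s\<close>])
      (rule dderiv_line[OF smooth_on_dderiv[OF assms(2)]], use \<sigma> in_S in simp)
  then obtain \<tau> where \<tau>: "0 < \<tau>" "\<tau> < s"
    "?h s - ?h 0 = s * dderiv b (dderiv a f) ((x + \<sigma> *\<^sub>R a) + \<tau> *\<^sub>R b)" by auto
  show ?thesis
    using \<sigma> \<tau> by (intro that[of \<sigma> \<tau>]) (simp_all add: algebra_simps power2_eq_square)
qed

text \<open>
Schwarz's theorem: the second difference over a shrinking parallelogram equals \<open>s\<^sup>2\<close> times either mixed
derivative at nearby points, and both mixed derivatives are continuous.
\<close>

lemma dderiv_commute:
  assumes "open S" "smooth_on S f" "x \<in> S"
  shows "dderiv a (dderiv b f) x = dderiv b (dderiv a f) x"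
proof (rule ccontr)
  let ?A = "dderiv a (dderiv b f)" and ?B = "dderiv b (dderiv a f)"
  assume ne: "?A x \<noteq> ?B x"
  define \<epsilon> where "\<epsilon> = \<bar>?A x - ?B x\<bar> / 2"
  have "\<epsilon> > 0" using ne by (simp add: \<epsilon>_def)
  have ev: "\<forall>\<^sub>F y in nhds x. \<bar>h y - h x\<bar> < \<epsilon>" if "smooth_on S h" for h :: "'a \<Rightarrow> real"
  proof -
    have "(h \<longlongrightarrow> h x) (nhds x)"
      using smooth_on_continuous_on[OF that] assms(1,3)
      by (simp add: continuous_on_eq_continuous_at isCont_def tendsto_at_iff_tendsto_nhds)
    from tendstoD[OF this \<open>\<epsilon> > 0\<close>] show ?thesis by (simp add: dist_real_def)
  qed
  have "\<forall>\<^sub>F y in nhds x. y \<in> S \<and> \<bar>?A y - ?A x\<bar> < \<epsilon> \<and> \<bar>?B y - ?B x\<bar> < \<epsilon>"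
    using eventually_nhds_in_open[OF assms(1,3)]
      ev[OF smooth_on_dderiv[OF smooth_on_dderiv[OF assms(2)]], of a b]
      ev[OF smooth_on_dderiv[OF smooth_on_dderiv[OF assms(2)]], of b a] by eventually_elim auto
  then obtain d where d: "d > 0" and
    D: "\<And>y. dist y x < d \<Longrightarrow> y \<in> S \<and> \<bar>?A y - ?A x\<bar> < \<epsilon> \<and> \<bar>?B y - ?B x\<bar> < \<epsilon>"
    by (auto simp: eventually_nhds_metric)
  define s where "s = d / (norm a + norm b + 1)"
  have s: "s > 0" using d by (simp add: s_def add_nonneg_pos)
  have near: "dist (x + \<sigma> *\<^sub>R a + \<tau> *\<^sub>R b) x < d"
    if "0 \<le> \<sigma>" "\<sigma> \<le> s" "0 \<le> \<tau>" "\<tau> \<le> s" for \<sigma> \<tau>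
  proof -
    have "dist (x + \<sigma> *\<^sub>R a + \<tau> *\<^sub>R b) x = norm (\<sigma> *\<^sub>R a + \<tau> *\<^sub>R b)"
      by (simp add: dist_norm algebra_simps)
    also have "\<dots> \<le> \<sigma> * norm a + \<tau> * norm b"
      using norm_triangle_ineq[of "\<sigma> *\<^sub>R a" "\<tau> *\<^sub>R b"] that by simp
    also have "\<dots> \<le> s * norm a + s * norm b"
      using that by (intro add_mono mult_right_mono) auto
    also have "\<dots> < s * (norm a + norm b + 1)" using s by (simp add: algebra_simps)
    also have "\<dots> = d" by (simp add: s_def add_nonneg_pos less_imp_neq[THEN not_sym])
    finally show ?thesis .
  qed
  obtain \<sigma> \<tau> where 1: "0 \<le> \<sigma>" "\<sigma> \<le> s" "0 \<le> \<tau>" "\<tau> \<le> s"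
    "f (x + s *\<^sub>R a + s *\<^sub>R b) - f (x + s *\<^sub>R a) - f (x + s *\<^sub>R b) + f x
      = s\<^sup>2 * ?B (x + \<sigma> *\<^sub>R a + \<tau> *\<^sub>R b)"
    using second_difference_mvt[OF assms(1,2) s, of x a b] D near by blast
  have near': "dist (x + \<sigma> *\<^sub>R b + \<tau> *\<^sub>R a) x < d"
    if "0 \<le> \<sigma>" "\<sigma> \<le> s" "0 \<le> \<tau>" "\<tau> \<le> s" for \<sigma> \<tau>
    using near[of \<tau> \<sigma>] that by (simp add: algebra_simps)
  obtain \<sigma>' \<tau>' where 2: "0 \<le> \<sigma>'" "\<sigma>' \<le> s" "0 \<le> \<tau>'" "\<tau>' \<le> s"
    "f (x + s *\<^sub>R b + s *\<^sub>R a) - f (x + s *\<^sub>R b) - f (x + s *\<^sub>R a) + f x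
      = s\<^sup>2 * ?A (x + \<sigma>' *\<^sub>R b + \<tau>' *\<^sub>R a)"
    using second_difference_mvt[OF assms(1,2) s, of x b a] D near' by blast
  have swap: "x + s *\<^sub>R b + s *\<^sub>R a = x + s *\<^sub>R a + s *\<^sub>R b" by (simp add: algebra_simps)
  have "s\<^sup>2 * ?B (x + \<sigma> *\<^sub>R a + \<tau> *\<^sub>R b) = s\<^sup>2 * ?A (x + \<sigma>' *\<^sub>R b + \<tau>' *\<^sub>R a)"
    using 1(5) 2(5)[unfolded swap] by linarith
  then have "?B (x + \<sigma> *\<^sub>R a + \<tau> *\<^sub>R b) = ?A (x + \<sigma>' *\<^sub>R b + \<tau>' *\<^sub>R a)" using s by simp
  moreover have "\<bar>?B (x + \<sigma> *\<^sub>R a + \<tau> *\<^sub>R b) - ?B x\<bar> < \<epsilon>" using D near 1 by blast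
  moreover have "\<bar>?A (x + \<sigma>' *\<^sub>R b + \<tau>' *\<^sub>R a) - ?A x\<bar> < \<epsilon>" using D near' 2 by blast
  ultimately have "\<bar>?A x - ?B x\<bar> < 2 * \<epsilon>" by linarith
  then show False by (simp add: \<epsilon>_def)
qed

lemma dderiv_square_commute:
  assumes "open S" "smooth_on S f" "x \<in> S"
  shows "dderiv v (dderiv a (dderiv a f)) x = dderiv a (dderiv a (dderiv v f)) x"
proof -
  have "dderiv v (dderiv a (dderiv a f)) x = dderiv a (dderiv v (dderiv a f)) x"
    using assms by (intro dderiv_commute smooth_on_dderiv)
  also have "\<dots> = dderiv a (dderiv a (dderiv v f)) x"
    by (rule dderiv_cong[OF assms(1,3)]) (use assms in \<open>auto intro: smooth_on_dderiv dderiv_commute\<close>)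
  finally show ?thesis .
qed

lemma second_dderiv_expand:
  assumes "open S" "smooth_on S u" "x \<in> S"
  shows "dderiv (e + t *\<^sub>R w) (dderiv (e + t *\<^sub>R w) u) x
    = dderiv e (dderiv e u) x + 2 * t * dderiv w (dderiv e u) x + t\<^sup>2 * dderiv w (dderiv w u) x"
  using assms
  by (simp add: dderiv_dderiv_add dderiv_dderiv_scale dderiv_add_left[OF smooth_on_dderiv]
      dderiv_scale_left[OF smooth_on_dderiv] dderiv_commute[of S u x e w] power2_eq_square algebra_simps)

lemma smooth_real_derivatives:
  assumes "smooth_on UNIV (G :: real \<Rightarrow> real)"
  shows "(G has_real_derivative deriv G t) (at t)"
    and "(deriv G has_real_derivative deriv (deriv G) t) (at t)"
proof -
  have D: "(g has_real_derivative deriv g t) (at t)" if "smooth_on UNIV g" for g :: "real \<Rightarrow> real" and t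
    using smooth_on_differentiable[OF that, of t] by (simp add: DERIV_deriv_iff_real_differentiable)
  have "deriv G = dderiv 1 G"
    using dderiv_eqI[OF D[OF assms, unfolded has_field_derivative_def], of 1] by auto
  then have "smooth_on UNIV (deriv G)" using smooth_on_dderiv[OF assms] by simp
  with D assms show "(G has_real_derivative deriv G t) (at t)"
    "(deriv G has_real_derivative deriv (deriv G) t) (at t)" by blast+
qed

section \<open>Second-order conditions at a minimum\<close>

text \<open>
Were the second derivative negative, the first derivative, which vanishes at \<open>0\<close>, would be negative just to
the right of \<open>0\<close>, and the function would decrease there.
\<close>

lemma second_derivative_test:
  fixes f f' :: "real \<Rightarrow> real"
  assumes f': "\<forall>\<^sub>F t in nhds 0. (f has_real_derivative f' t) (at t)"
    and f'': "(f' has_real_derivative d) (at 0)"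
    and min: "\<forall>\<^sub>F t in nhds 0. f 0 \<le> f t"
  shows "f' 0 = 0" "0 \<le> d"
proof -
  obtain \<epsilon> where \<epsilon>: "\<epsilon> > 0" and E: "\<And>t. \<bar>t\<bar> < \<epsilon> \<Longrightarrow> (f has_real_derivative f' t) (at t) \<and> f 0 \<le> f t"
    using eventually_conj[OF f' min] by (auto simp: eventually_nhds_metric dist_real_def)
  show 0: "f' 0 = 0"
    using DERIV_local_min[of f "f' 0" 0 \<epsilon>] E \<epsilon> by simp
  show "0 \<le> d"
  proof (rule ccontr)
    assume "\<not> 0 \<le> d"
    then obtain \<delta> where \<delta>: "\<delta> > 0" "\<And>h. 0 < h \<Longrightarrow> h < \<delta> \<Longrightarrow> f' h < 0"
      using DERIV_neg_dec_right[OF f''] 0 by auto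
    define s where "s = min \<epsilon> \<delta> / 2"
    have s: "0 < s" "s < \<epsilon>" "s < \<delta>" using \<epsilon> \<delta> by (auto simp: s_def)
    have "\<exists>z. 0 < z \<and> z < s \<and> f s - f 0 = (s - 0) * f' z"
      by (rule MVT2) (use s E in auto)
    then obtain z where z: "0 < z" "z < s" "f s - f 0 = s * f' z" by auto
    have "s * f' z < 0" using \<delta>(2)[of z] z s by (simp add: mult_pos_neg)
    with z(3) E[of s] s show False by simp
  qed
qed

text \<open>
The expression tested is \<open>tr E - tr E\<^sup>2 / 2 + tr E\<^sup>3 / 3\<close>, which agrees with \<open>ln det (1 + E)\<close> to third
order in \<open>E\<close>. As \<open>E\<close> vanishes at \<open>0\<close>, the cubic term does not affect the first two derivatives there, and the
second derivative is that of \<open>ln det\<close> at the identity.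
\<close>

lemma matrix_second_derivative_test:
  fixes E E1 :: "real \<Rightarrow> 'n::finite \<Rightarrow> 'n \<Rightarrow> real"
  assumes E0: "\<And>i j. E 0 i j = 0"
    and E1: "\<forall>\<^sub>F t in nhds 0. \<forall>i j. ((\<lambda>t. E t i j) has_real_derivative E1 t i j) (at t)"
    and E2: "\<And>i j. ((\<lambda>t. E1 t i j) has_real_derivative E2 i j) (at 0)"
    and ge: "\<forall>\<^sub>F t in nhds 0. 0 \<le> (\<Sum>i\<in>UNIV. E t i i) - (\<Sum>i\<in>UNIV. \<Sum>j\<in>UNIV. E t i j * E t j i) / 2
      + (\<Sum>i\<in>UNIV. \<Sum>j\<in>UNIV. \<Sum>k\<in>UNIV. E t i j * E t j k * E t k i) / 3"
  shows "(\<Sum>i\<in>UNIV. E1 0 i i) = 0"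
    and "(\<Sum>i\<in>UNIV. \<Sum>j\<in>UNIV. E1 0 i j * E1 0 j i) \<le> (\<Sum>i\<in>UNIV. E2 i i)"
proof -
  define f where "f t = (\<Sum>i\<in>UNIV. E t i i) - (\<Sum>i\<in>UNIV. \<Sum>j\<in>UNIV. E t i j * E t j i) / 2
      + (\<Sum>i\<in>UNIV. \<Sum>j\<in>UNIV. \<Sum>k\<in>UNIV. E t i j * E t j k * E t k i) / 3" for t
  define f' where "f' t = (\<Sum>i\<in>UNIV. E1 t i i)
    - (\<Sum>i\<in>UNIV. \<Sum>j\<in>UNIV. E1 t i j * E t j i + E t i j * E1 t j i) / 2
    + (\<Sum>i\<in>UNIV. \<Sum>j\<in>UNIV. \<Sum>k\<in>UNIV. E1 t i j * E t j k * E t k i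
        + E t i j * E1 t j k * E t k i + E t i j * E t j k * E1 t k i) / 3" for t
  have 1: "\<forall>\<^sub>F t in nhds 0. (f has_real_derivative f' t) (at t)"
    using E1
  proof eventually_elim
    case (elim t)
    then have d: "((\<lambda>t. E t i j) has_real_derivative E1 t i j) (at t)" for i j by blast
    have "((\<lambda>t. \<Sum>i\<in>UNIV. E t i i) has_real_derivative (\<Sum>i\<in>UNIV. E1 t i i)) (at t)"
      by (intro DERIV_sum d)
    moreover have "((\<lambda>t. \<Sum>i\<in>UNIV. \<Sum>j\<in>UNIV. E t i j * E t j i) has_real_derivative
        (\<Sum>i\<in>UNIV. \<Sum>j\<in>UNIV. E1 t i j * E t j i + E t i j * E1 t j i)) (at t)"
      by (intro DERIV_sum) (rule derivative_eq_intros d refl | simp)+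
    moreover have "((\<lambda>t. \<Sum>i\<in>UNIV. \<Sum>j\<in>UNIV. \<Sum>k\<in>UNIV. E t i j * E t j k * E t k i) has_real_derivative
        (\<Sum>i\<in>UNIV. \<Sum>j\<in>UNIV. \<Sum>k\<in>UNIV. E1 t i j * E t j k * E t k i
          + E t i j * E1 t j k * E t k i + E t i j * E t j k * E1 t k i)) (at t)"
      by (intro DERIV_sum) (rule derivative_eq_intros d refl | simp add: algebra_simps)+
    ultimately show ?case
      unfolding f_def f'_def by (intro DERIV_add DERIV_diff DERIV_cdivide)
  qed
  have d0: "((\<lambda>t. E t i j) has_real_derivative E1 0 i j) (at 0)" for i j
    using eventually_nhds_x_imp_x[OF E1] by blast
  have "((\<lambda>t. \<Sum>i\<in>UNIV. E1 t i i) has_real_derivative (\<Sum>i\<in>UNIV. E2 i i)) (at 0)"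
    by (intro DERIV_sum E2)
  moreover have "((\<lambda>t. \<Sum>i\<in>UNIV. \<Sum>j\<in>UNIV. E1 t i j * E t j i + E t i j * E1 t j i)
      has_real_derivative (\<Sum>i\<in>UNIV. \<Sum>j\<in>UNIV. 2 * (E1 0 i j * E1 0 j i))) (at 0)"
    by (intro DERIV_sum) (rule derivative_eq_intros d0 E2 refl | simp add: E0)+
  moreover have "((\<lambda>t. \<Sum>i\<in>UNIV. \<Sum>j\<in>UNIV. \<Sum>k\<in>UNIV. E1 t i j * E t j k * E t k i
        + E t i j * E1 t j k * E t k i + E t i j * E t j k * E1 t k i)
      has_real_derivative (\<Sum>i::'n\<in>UNIV. \<Sum>j::'n\<in>UNIV. \<Sum>k::'n\<in>UNIV. 0)) (at 0)"
    by (intro DERIV_sum) (rule derivative_eq_intros d0 E2 refl | simp add: E0)+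
  ultimately have "(f' has_real_derivative ((\<Sum>i\<in>UNIV. E2 i i)
      - (\<Sum>i\<in>UNIV. \<Sum>j\<in>UNIV. 2 * (E1 0 i j * E1 0 j i)) / 2
      + (\<Sum>i::'n\<in>UNIV. \<Sum>j::'n\<in>UNIV. \<Sum>k::'n\<in>UNIV. 0) / 3)) (at 0)"
    unfolding f'_def by (intro DERIV_add DERIV_diff DERIV_cdivide)
  then have 2: "(f' has_real_derivative ((\<Sum>i\<in>UNIV. E2 i i) - (\<Sum>i\<in>UNIV. \<Sum>j\<in>UNIV. E1 0 i j * E1 0 j i))) (at 0)"
    by (simp add: sum_distrib_left[symmetric])
  have "f 0 = 0" by (simp add: f_def E0)
  then have 3: "\<forall>\<^sub>F t in nhds 0. f 0 \<le> f t" using ge by (simp add: f_def)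
  show "(\<Sum>i\<in>UNIV. E1 0 i i) = 0"
    using second_derivative_test(1)[OF 1 2 3] by (simp add: f'_def E0)
  show "(\<Sum>i\<in>UNIV. \<Sum>j\<in>UNIV. E1 0 i j * E1 0 j i) \<le> (\<Sum>i\<in>UNIV. E2 i i)"
    using second_derivative_test(2)[OF 1 2 3] by simp
qed

section \<open>Symmetric matrices\<close>

lemma symmetric_matrix_inner:
  fixes A :: "real ^ 'n ^ 'n"
  assumes "transpose A = A"
  shows "(A *v x) \<bullet> y = x \<bullet> (A *v y)"
  using assms by (metis dot_lmul_matrix vector_transpose_matrix)

text \<open>
If \<open>A v = w \<noteq> 0\<close>, then the quadratic form decreases below \<open>0\<close> when \<open>v\<close> is moved slightly in the direction
\<open>- w\<close>. Restricting to a subspace allows the same argument to show that a maximiser of the quadratic form on the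
unit sphere of an invariant subspace is an eigenvector.
\<close>

lemma psd_on_null_vector:
  fixes A :: "real ^ 'n ^ 'n"
  assumes "subspace V" "\<And>v. v \<in> V \<Longrightarrow> 0 \<le> v \<bullet> (A *v v)" "transpose A = A"
    "v \<in> V" "A *v v \<in> V" "v \<bullet> (A *v v) = 0"
  shows "A *v v = 0"
proof (rule ccontr)
  assume ne: "A *v v \<noteq> 0"
  define w where "w = A *v v"
  define c where "c = w \<bullet> (A *v w)"
  have sym: "v \<bullet> (A *v w) = w \<bullet> w"
    using symmetric_matrix_inner[OF assms(3), of v w] by (simp add: w_def)
  have ww: "w \<bullet> w > 0" using ne by (simp add: w_def)
  have "c \<ge> 0" using assms(2,5) by (simp add: w_def c_def)
  have quad: "0 \<le> 2 * t * (w \<bullet> w) + t\<^sup>2 * c" for t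
  proof -
    have "v + t *\<^sub>R w \<in> V" using assms(1,4,5) by (simp add: w_def subspace_add subspace_scale)
    then have "0 \<le> (v + t *\<^sub>R w) \<bullet> (A *v (v + t *\<^sub>R w))" by (rule assms(2))
    also have "\<dots> = v \<bullet> (A *v v) + t * (v \<bullet> (A *v w)) + t * (w \<bullet> (A *v v)) + t\<^sup>2 * c"
      by (simp add: matrix_vector_right_distrib matrix_vector_mult_scaleR inner_simps c_def
          power2_eq_square algebra_simps)
    finally show ?thesis using assms(6) sym by (simp add: w_def[symmetric])
  qed
  \<comment> \<open>Adding 1 to the curvature keeps the denominator positive and leaves a strictly negative remainder.\<close>
  define t where "t = - (w \<bullet> w) / (c + 1)"
  have "t * (c + 1) = - (w \<bullet> w)" using \<open>c \<ge> 0\<close> by (simp add: t_def)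
  then have "t * (t * (c + 1)) = t * - (w \<bullet> w)" by simp
  then have "t\<^sup>2 * c = - t * (w \<bullet> w) - t\<^sup>2" by (simp add: power2_eq_square algebra_simps)
  with quad[of t] have "0 \<le> t * (w \<bullet> w)" using zero_le_power2[of t] by linarith
  moreover have "t < 0" using ww \<open>c \<ge> 0\<close> by (simp add: t_def divide_neg_pos)
  ultimately show False using ww by (simp add: zero_le_mult_iff)
qed

lemma psd_det_zero_iff:
  fixes A :: "real ^ 'n ^ 'n"
  assumes "pos_semidef A" "transpose A = A"
  shows "det A = 0 \<longleftrightarrow> (\<exists>e. e \<bullet> e = 1 \<and> e \<bullet> (A *v e) = 0)"
proof
  assume "det A = 0"
  then obtain v where v: "v \<noteq> 0" "A *v v = 0"
    by (metis invertible_det_nz invertible_left_inverse matrix_left_invertible_ker)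
  then show "\<exists>e. e \<bullet> e = 1 \<and> e \<bullet> (A *v e) = 0"
    by (intro exI[of _ "sgn v"]) (simp add: sgn_div_norm matrix_vector_mult_scaleR dot_square_norm power2_eq_square)
next
  assume "\<exists>e. e \<bullet> e = 1 \<and> e \<bullet> (A *v e) = 0"
  then obtain e where e: "e \<bullet> e = 1" "e \<bullet> (A *v e) = 0" by blast
  have "A *v e = 0"
    using psd_on_null_vector[OF subspace_UNIV _ assms(2) _ _ e(2)] assms(1) by (simp add: pos_semidef_def)
  moreover have "e \<noteq> 0" using e(1) by auto
  ultimately show "det A = 0"
    by (metis invertible_det_nz invertible_left_inverse matrix_left_invertible_ker)
qed

text \<open>
At a maximiser \<open>e\<close> of the quadratic form on the unit sphere of \<open>V\<close>, with maximum \<open>c\<close>, the matrix \<open>c - A\<close> is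
positive semidefinite on \<open>V\<close> and \<open>e\<close> is a null vector of its quadratic form.
\<close>

lemma symmetric_matrix_eigenvector_in_subspace:
  fixes A :: "real ^ 'n ^ 'n"
  assumes "transpose A = A" "subspace V" "V \<noteq> {0}" and inv: "\<And>v. v \<in> V \<Longrightarrow> A *v v \<in> V"
  obtains e c where "e \<in> V" "norm e = 1" "A *v e = c *\<^sub>R e"
proof -
  have "compact (V \<inter> sphere 0 1)"
    using closed_subspace[OF assms(2)] by (simp add: closed_Int_compact)
  moreover obtain v0 where v0: "v0 \<in> V" "v0 \<noteq> 0" using assms(2,3) subspace_0 by blast
  then have "sgn v0 \<in> V \<inter> sphere 0 1" using assms(2) by (simp add: norm_sgn sgn_div_norm subspace_scale)
  then have "V \<inter> sphere 0 1 \<noteq> {}" by blast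
  moreover have "continuous_on (V \<inter> sphere 0 1) (\<lambda>v. v \<bullet> (A *v v))"
    by (intro continuous_intros linear_continuous_on_compose[OF continuous_on_id] matrix_vector_mul_linear)
  ultimately obtain e where e: "e \<in> V" "norm e = 1"
    "\<And>v. v \<in> V \<Longrightarrow> norm v = 1 \<Longrightarrow> v \<bullet> (A *v v) \<le> e \<bullet> (A *v e)"
    using continuous_attains_sup[of "V \<inter> sphere 0 1" "\<lambda>v. v \<bullet> (A *v v)"] by force
  define c where "c = e \<bullet> (A *v e)"
  define M where "M = c *\<^sub>R mat 1 - A"
  have M: "M *v v = c *\<^sub>R v - A *v v" for v
    by (simp add: M_def matrix_vector_mult_diff_rdistrib scaleR_matrix_vector_assoc[symmetric])
  have "M *v e = 0"
  proof (rule psd_on_null_vector[OF assms(2)])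
    fix v assume v: "v \<in> V"
    show "0 \<le> v \<bullet> (M *v v)"
    proof (cases "v = 0")
      case False
      have scale: "(t *\<^sub>R w) \<bullet> (A *v (t *\<^sub>R w)) = t\<^sup>2 * (w \<bullet> (A *v w))" for t w
        by (simp add: matrix_vector_mult_scaleR power2_eq_square)
      have "norm v *\<^sub>R sgn v = v" using False by (simp add: sgn_div_norm)
      then have "v \<bullet> (A *v v) = (norm v)\<^sup>2 * (sgn v \<bullet> (A *v sgn v))"
        using scale[of "norm v" "sgn v"] by simp
      also have "\<dots> \<le> (norm v)\<^sup>2 * c"
        unfolding c_def using v False assms(2)
        by (intro mult_left_mono e(3)) (auto simp: norm_sgn sgn_div_norm subspace_scale)
      finally show ?thesis by (simp add: M inner_simps power2_norm_eq_inner mult.commute)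
    qed simp
  next
    show "transpose M = M"
      using assms(1) by (simp add: M_def vec_eq_iff transpose_def mat_def)
    show "M *v e \<in> V" using e(1) inv assms(2) by (simp add: M subspace_diff subspace_scale)
    show "e \<bullet> (M *v e) = 0" using e(2) by (simp add: M inner_simps c_def dot_square_norm)
  qed (rule e(1))
  then show ?thesis using that[OF e(1,2), of c] by (simp add: M)
qed

text \<open>
The spectral theorem by induction on the dimension: the orthogonal complement of an eigenvector in an invariant
subspace is again invariant.
\<close>

lemma symmetric_matrix_eigenbasis_subspace:
  fixes A :: "real ^ 'n ^ 'n"
  assumes "transpose A = A"
  shows "\<lbrakk>subspace V; \<And>v. v \<in> V \<Longrightarrow> A *v v \<in> V\<rbrakk>
    \<Longrightarrow> \<exists>B. B \<subseteq> V \<and> V \<subseteq> span B \<and> pairwise orthogonal B \<and> (\<forall>b\<in>B. norm b = 1 \<and> (\<exists>c. A *v b = c *\<^sub>R b))"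
proof (induction "dim V" arbitrary: V rule: less_induct)
  case less
  show ?case
  proof (cases "V = {0}")
    case True then show ?thesis by (intro exI[of _ "{}"]) auto
  next
    case False
    obtain e c where e: "e \<in> V" "norm e = 1" "A *v e = c *\<^sub>R e"
      using symmetric_matrix_eigenvector_in_subspace[OF assms less.prems(1) False less.prems(2)] by blast
    define V' where "V' = {v \<in> V. v \<bullet> e = 0}"
    have sub: "subspace V'"
      using less.prems(1) by (auto simp: V'_def subspace_def inner_simps)
    have ee: "e \<bullet> e = 1" using e(2) by (simp add: norm_eq_1)
    then have "e \<notin> V'" by (simp add: V'_def)
    moreover have "V' \<subseteq> V" by (auto simp: V'_def)
    ultimately have "V' \<subset> V" using e(1) by blast
    then have "dim V' < dim V"
      using dim_psubset[of V' V] span_eq_iff sub less.prems(1) by metis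
    moreover have "A *v v \<in> V'" if "v \<in> V'" for v
      using that less.prems(2) by (simp add: V'_def symmetric_matrix_inner[OF assms] e(3))
    ultimately obtain B where B: "B \<subseteq> V'" "V' \<subseteq> span B" "pairwise orthogonal B"
      "\<forall>b\<in>B. norm b = 1 \<and> (\<exists>c. A *v b = c *\<^sub>R b)"
      using less.hyps[OF _ sub] by blast
    show ?thesis
    proof (intro exI[of _ "insert e B"] conjI)
      show "insert e B \<subseteq> V" using B(1) e(1) by (auto simp: V'_def)
      show "V \<subseteq> span (insert e B)"
      proof
        fix v assume v: "v \<in> V"
        have "v - (v \<bullet> e) *\<^sub>R e \<in> V'"
          using v e(1) less.prems(1) ee by (simp add: V'_def subspace_diff subspace_scale inner_simps)
        then show "v \<in> span (insert e B)" using B(2) by (auto simp: span_insert)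
      qed
      show "pairwise orthogonal (insert e B)"
        using B(1,3) by (auto simp: pairwise_insert V'_def orthogonal_def inner_commute)
      show "\<forall>b\<in>insert e B. norm b = 1 \<and> (\<exists>c. A *v b = c *\<^sub>R b)" using B(4) e by auto
    qed
  qed
qed

lemma symmetric_matrix_eigenbasis:
  fixes A :: "real ^ 'n ^ 'n"
  assumes "transpose A = A"
  obtains q :: "'n \<Rightarrow> real ^ 'n" and l :: "'n \<Rightarrow> real"
  where "\<And>i j. q i \<bullet> q j = (if i = j then 1 else 0)" "\<And>i. A *v q i = l i *\<^sub>R q i"
proof -
  obtain B where B: "UNIV \<subseteq> span B" "pairwise orthogonal B"
    "\<forall>b\<in>B. norm b = 1 \<and> (\<exists>c. A *v b = c *\<^sub>R b)"
    using symmetric_matrix_eigenbasis_subspace[OF assms subspace_UNIV] by auto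
  have ind: "independent B"
    using B(2,3) by (intro pairwise_orthogonal_independent) auto
  have "card B = dim (UNIV :: (real ^ 'n) set)"
    by (rule basis_card_eq_dim) (use B(1) ind in auto)
  then have "card (UNIV :: 'n set) = card B" by simp
  moreover have "finite B" using ind independent_imp_finite by blast
  ultimately obtain q where q: "bij_betw q (UNIV :: 'n set) B"
    using finite_same_card_bij[of "UNIV :: 'n set" B] by auto
  have qB: "q i \<in> B" for i using q by (auto simp: bij_betw_def)
  have orth: "q i \<bullet> q j = (if i = j then 1 else 0)" for i j
  proof (cases "i = j")
    case True then show ?thesis using B(3) qB[of i] by (simp add: norm_eq_1)
  next
    case False
    then have "q i \<noteq> q j" using q by (auto simp: bij_betw_def inj_def)
    then show ?thesis using B(2) qB[of i] qB[of j] False by (simp add: pairwise_def orthogonal_def)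
  qed
  have "\<forall>i. \<exists>c. A *v q i = c *\<^sub>R q i" using B(3) qB by blast
  then obtain l where "\<And>i. A *v q i = l i *\<^sub>R q i" by metis
  with orth show ?thesis using that by blast
qed

lemma congruence_nth:
  fixes A :: "real ^ 'n ^ 'n"
  assumes "\<And>i j. R $ i $ j = r j $ i"
  shows "(transpose R ** A ** R) $ i $ j = r i \<bullet> (A *v r j)"
  unfolding matrix_mul_assoc[symmetric]
  by (simp add: matrix_matrix_mult_def transpose_def inner_vec_def
      matrix_vector_mult_def assms)

text \<open>
The trace is invariant under the orthogonal change of basis to \<open>q\<close>.
\<close>

lemma trace_orthonormal_basis:
  fixes A :: "real ^ 'n ^ 'n" and q :: "'n \<Rightarrow> real ^ 'n"
  assumes "\<And>i j. q i \<bullet> q j = (if i = j then 1 else 0)"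
  shows "trace A = (\<Sum>i\<in>UNIV. q i \<bullet> (A *v q i))"
proof -
  define Q :: "real ^ 'n ^ 'n" where "Q = (\<chi> i j. q j $ i)"
  have nth: "Q $ i $ j = q j $ i" for i j by (simp add: Q_def)
  have "transpose Q ** mat 1 ** Q = mat 1"
    by (simp only: vec_eq_iff congruence_nth[OF nth] matrix_vector_mul_lid assms) (simp add: mat_def)
  then have "Q ** transpose Q = mat 1" by (simp add: matrix_left_right_inverse)
  then have "trace A = trace (A ** Q ** transpose Q)" by (simp add: matrix_mul_assoc[symmetric])
  also have "\<dots> = trace (transpose Q ** A ** Q)" by (simp add: trace_mul_sym[of "A ** Q"] matrix_mul_assoc)
  finally show ?thesis unfolding trace_def congruence_nth[OF nth] .
qed

text \<open>
The difference of the two sides has derivative \<open>(x - 1)\<^sup>3 / x\<close> and hence its minimum at \<open>x = 1\<close>. The Taylor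
polynomial of odd degree is the upper one on the whole half-line.
\<close>

lemma ln_le_cubic_taylor:
  fixes x :: real
  assumes "0 < x"
  shows "ln x \<le> (x - 1) - (x - 1)\<^sup>2 / 2 + (x - 1) ^ 3 / 3"
proof -
  define g where "g x = (x - 1) - (x - 1)\<^sup>2 / 2 + (x - 1) ^ 3 / 3 - ln x" for x :: real
  have g': "(g has_real_derivative (x - 1) ^ 3 / x) (at x)" if "x > 0" for x
  proof -
    have "(g has_real_derivative 1 - (x - 1) + (x - 1)\<^sup>2 - 1 / x) (at x)"
      unfolding g_def using that by (auto intro!: derivative_eq_intros simp: diff_divide_distrib)
    also have "1 - (x - 1) + (x - 1)\<^sup>2 - 1 / x = (x - 1) ^ 3 / x"
      using that by (simp add: power2_eq_square power3_eq_cube field_simps)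
    finally show ?thesis .
  qed
  have "g 1 \<le> g x"
  proof (cases "1 \<le> x")
    case True
    show ?thesis
    proof (rule DERIV_nonneg_imp_nondecreasing[OF True])
      fix t assume t: "1 \<le> t" "t \<le> x"
      then show "\<exists>y. (g has_real_derivative y) (at t) \<and> 0 \<le> y" using g'[of t]
        by (intro exI[of _ "(t - 1) ^ 3 / t"]) auto
    qed
  next
    case False
    show ?thesis
    proof (rule DERIV_nonpos_imp_nonincreasing[where f = g and a = x and b = 1])
      show "x \<le> 1" using False by simp
      fix t assume t: "x \<le> t" "t \<le> 1"
      have "(t - 1) ^ 3 / t \<le> 0"
        using t assms by (intro divide_nonpos_pos) (auto simp: power3_eq_cube mult_nonneg_nonpos mult_nonpos_nonpos)
      then show "\<exists>y. (g has_real_derivative y) (at t) \<and> y \<le> 0" using g'[of t] t assms by auto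
    qed
  qed
  then show ?thesis by (simp add: g_def)
qed

text \<open>
Summing the cubic bound for the logarithm over the eigenvalues of \<open>N\<close> gives
\<open>0 \<le> ln det N \<le> tr E - tr E\<^sup>2 / 2 + tr E\<^sup>3 / 3\<close>. The right-hand side is polynomial in the entries of \<open>N\<close>,
so a lower bound on a determinant can be differentiated twice without differentiating the determinant itself.
\<close>

lemma det_ge_one_trace_inequality:
  fixes N :: "real ^ 'n ^ 'n"
  assumes "transpose N = N" "pos_semidef N" "1 \<le> det N"
  defines "E \<equiv> N - mat 1"
  shows "0 \<le> trace E - trace (E ** E) / 2 + trace (E ** E ** E) / 3"
proof -
  obtain q :: "'n \<Rightarrow> real ^ 'n" and l where q: "\<And>i j. q i \<bullet> q j = (if i = j then 1 else 0)" and l: "\<And>i. N *v q i = l i *\<^sub>R q i"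
    using symmetric_matrix_eigenbasis[OF assms(1)] by blast
  define Q :: "real ^ 'n ^ 'n" where "Q = (\<chi> i j. q j $ i)"
  have nth: "Q $ i $ j = q j $ i" for i j by (simp add: Q_def)
  have "transpose Q ** mat 1 ** Q = mat 1"
    by (simp only: vec_eq_iff congruence_nth[OF nth] matrix_vector_mul_lid q) (simp add: mat_def)
  then have QQ: "transpose Q ** Q = mat 1" by simp
  have "det (transpose Q ** N ** Q) = (\<Prod>i\<in>UNIV. l i)"
    by (subst det_diagonal) (simp_all add: congruence_nth[OF nth] l q)
  moreover have "det Q * det Q = 1" using arg_cong[OF QQ, of det] by (simp add: det_mul)
  ultimately have det: "det N = (\<Prod>i\<in>UNIV. l i)" by (simp add: det_mul algebra_simps)
  have "l i = q i \<bullet> (N *v q i)" for i by (simp add: l q)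
  then have "0 \<le> l i" for i using assms(2) by (simp add: pos_semidef_def)
  moreover have "l i \<noteq> 0" for i
  proof
    assume "l i = 0"
    then have "(\<Prod>i\<in>UNIV. l i) = 0" by (intro prod_zero) auto
    then have "det N = 0" using det by (simp only:)
    then show False using assms(3) by simp
  qed
  ultimately have lpos: "0 < l i" for i by (simp add: less_le)
  have E: "E *v q i = (l i - 1) *\<^sub>R q i" for i
    by (simp add: E_def matrix_vector_mult_diff_rdistrib l algebra_simps)
  have E2: "(E ** E) *v q i = (l i - 1)\<^sup>2 *\<^sub>R q i" for i
    by (simp add: matrix_vector_mul_assoc[symmetric] E matrix_vector_mult_scaleR power2_eq_square)
  have E3: "(E ** E ** E) *v q i = (l i - 1) ^ 3 *\<^sub>R q i" for i
    by (simp add: matrix_vector_mul_assoc[symmetric] E E2 matrix_vector_mult_scaleR power3_eq_cube power2_eq_square)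
  have "0 \<le> ln (det N)" using assms(3) by simp
  also have "ln (det N) = (\<Sum>i\<in>UNIV. ln (l i))" unfolding det by (intro ln_prod finite less_imp_neq[OF lpos, THEN not_sym])
  also have "\<dots> \<le> (\<Sum>i\<in>UNIV. (l i - 1) - (l i - 1)\<^sup>2 / 2 + (l i - 1) ^ 3 / 3)"
    by (rule sum_mono) (rule ln_le_cubic_taylor[OF lpos])
  also have "\<dots> = trace E - trace (E ** E) / 2 + trace (E ** E ** E) / 3"
    unfolding trace_orthonormal_basis[OF q] E E2 E3
    by (simp add: q sum.distrib sum_subtractf sum_divide_distrib)
  finally show ?thesis .
qed

section \<open>The Hessian as a bilinear form\<close>

lemma partial_deriv_eq_dderiv: "partial_deriv i f = dderiv (axis i 1) f"
  by (simp add: fun_eq_iff partial_deriv_def dderiv_def)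

lemma hessian_nth: "hessian u x $ i $ j = dderiv (axis i 1) (dderiv (axis j 1) u) x"
  by (simp add: hessian_def partial_deriv_eq_dderiv)

lemma laplacian_eq_sum: "laplacian u x = (\<Sum>k\<in>UNIV. dderiv (axis k 1) (dderiv (axis k 1) u) x)"
  by (simp add: laplacian_def trace_def hessian_nth)

lemma second_dderiv_sum:
  fixes u :: "real ^ 'n \<Rightarrow> real"
  assumes "open S" "smooth_on S u" "x \<in> S"
  shows "dderiv v (dderiv w u) x
    = (\<Sum>i\<in>UNIV. \<Sum>j\<in>UNIV. v $ i * w $ j * dderiv (axis i 1) (dderiv (axis j 1) u) x)"
proof -
  have exp: "(\<Sum>i\<in>UNIV. y $ i *\<^sub>R axis i 1) = y" for y :: "real ^ 'n"
    using basis_expansion[of y] by (simp add: scalar_mult_eq_scaleR)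
  have "dderiv v (dderiv w u) x = dderiv v (dderiv (\<Sum>j\<in>UNIV. w $ j *\<^sub>R axis j 1) u) x"
    by (simp add: exp)
  also have "\<dots> = (\<Sum>j\<in>UNIV. w $ j * dderiv v (dderiv (axis j 1) u) x)"
    by (rule dderiv_dderiv_sum[OF assms])
  also have "\<dots> = (\<Sum>j\<in>UNIV. w $ j * dderiv (\<Sum>i\<in>UNIV. v $ i *\<^sub>R axis i 1) (dderiv (axis j 1) u) x)"
    by (simp add: exp)
  also have "\<dots> = (\<Sum>j\<in>UNIV. w $ j * (\<Sum>i\<in>UNIV. v $ i * dderiv (axis i 1) (dderiv (axis j 1) u) x))"
    by (subst dderiv_sum_left[OF smooth_on_dderiv[OF assms(2)] assms(3)]) simp
  also have "\<dots> = (\<Sum>j\<in>UNIV. \<Sum>i\<in>UNIV. v $ i * w $ j * dderiv (axis i 1) (dderiv (axis j 1) u) x)"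
    by (simp add: sum_distrib_left mult_ac)
  finally show ?thesis by (subst sum.swap)
qed

lemma inner_hessian:
  fixes u :: "real ^ 'n \<Rightarrow> real"
  assumes "open S" "smooth_on S u" "x \<in> S"
  shows "v \<bullet> (hessian u x *v w) = dderiv v (dderiv w u) x"
  by (subst second_dderiv_sum[OF assms]) (simp add: inner_vec_def matrix_vector_mult_def hessian_nth
      sum_distrib_left mult_ac)

lemma hessian_symmetric:
  fixes u :: "real ^ 'n \<Rightarrow> real"
  assumes "open S" "smooth_on S u" "x \<in> S"
  shows "transpose (hessian u x) = hessian u x"
  by (simp add: vec_eq_iff transpose_def hessian_nth dderiv_commute[OF assms])

lemma det_hessian_zero_iff:
  fixes u :: "real ^ 'n \<Rightarrow> real"
  assumes "open S" "smooth_on S u" "x \<in> S" and psd: "\<And>v. 0 \<le> dderiv v (dderiv v u) x"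
  shows "det (hessian u x) = 0 \<longleftrightarrow> (\<exists>e. norm e = 1 \<and> dderiv e (dderiv e u) x = 0)"
  using psd_det_zero_iff[of "hessian u x"] hessian_symmetric[OF assms(1-3)] psd
  by (simp add: pos_semidef_def inner_hessian[OF assms(1-3)] norm_eq_1)

lemma continuous_on_det_hessian:
  fixes u :: "real ^ 'n \<Rightarrow> real"
  assumes "smooth_on S u"
  shows "continuous_on S (\<lambda>x. det (hessian u x))"
  unfolding det_def hessian_nth
  by (intro continuous_intros smooth_on_continuous_on smooth_on_dderiv assms)

lemma continuous_on_hessian_form:
  fixes u :: "real ^ 'n \<Rightarrow> real"
  assumes "open S" "smooth_on S u" "K \<subseteq> S"
  shows "continuous_on (K \<times> UNIV) (\<lambda>(x, e). dderiv e (dderiv e u) x)"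
proof -
  have c: "continuous_on K (dderiv a (dderiv b u))" for a b
    using smooth_on_continuous_on[OF smooth_on_dderiv[OF smooth_on_dderiv[OF assms(2)]]] assms(3)
      continuous_on_subset by blast
  have "continuous_on (K \<times> UNIV) (\<lambda>p. \<Sum>i\<in>UNIV. \<Sum>j\<in>UNIV.
      snd p $ i * snd p $ j * dderiv (axis i 1) (dderiv (axis j 1) u) (fst p))"
    by (intro continuous_intros continuous_on_compose2[OF c]) auto
  then show ?thesis
    by (rule continuous_on_cong[THEN iffD1, rotated -1])
      (use assms(3) in \<open>auto simp: second_dderiv_sum[OF assms(1,2)]\<close>)
qed

lemma sum_second_dderiv_orthonormal:
  fixes u :: "real ^ 'n \<Rightarrow> real" and q :: "'n \<Rightarrow> real ^ 'n"
  assumes "open S" "smooth_on S u" "x \<in> S" "\<And>i j. q i \<bullet> q j = (if i = j then 1 else 0)"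
  shows "(\<Sum>k\<in>UNIV. dderiv (q k) (dderiv (q k) u) x) = laplacian u x"
  by (simp add: laplacian_def trace_orthonormal_basis[OF assms(4)] inner_hessian[OF assms(1-3)])

section \<open>The differentiated equation\<close>

text \<open>
A constant-coefficient second-order operator commutes with directional derivatives.
\<close>

lemma sum_second_dderiv_differentiate:
  assumes "open S" "smooth_on S f"
    and eq: "\<And>y. y \<in> S \<Longrightarrow> (\<Sum>k\<in>K. dderiv (q k) (dderiv (q k) f) y) = g y"
    and x: "x \<in> S" and g': "(g has_derivative g') (at x)"
  shows "(\<Sum>k\<in>K. dderiv (q k) (dderiv (q k) (dderiv v f)) x) = g' v"
proof -
  have "((\<lambda>y. \<Sum>k\<in>K. dderiv (q k) (dderiv (q k) f) y) has_derivative
      (\<lambda>v. \<Sum>k\<in>K. dderiv v (dderiv (q k) (dderiv (q k) f)) x)) (at x)"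
    by (intro has_derivative_sum smooth_on_has_derivative[where S=S] smooth_on_dderiv assms)
  then have "(g has_derivative (\<lambda>v. \<Sum>k\<in>K. dderiv v (dderiv (q k) (dderiv (q k) f)) x)) (at x)"
    by (rule has_derivative_transform_within_open[OF _ assms(1) x]) (rule eq)
  then have "g' = (\<lambda>v. \<Sum>k\<in>K. dderiv v (dderiv (q k) (dderiv (q k) f)) x)"
    by (rule has_derivative_unique[OF g'])
  then have "g' v = (\<Sum>k\<in>K. dderiv v (dderiv (q k) (dderiv (q k) f)) x)" by (rule fun_cong)
  also have "\<dots> = (\<Sum>k\<in>K. dderiv (q k) (dderiv (q k) (dderiv v f)) x)"
    by (rule sum.cong[OF refl], rule dderiv_square_commute[OF assms(1,2) x])
  finally show ?thesis ..
qed

lemma semilinear_differentiated: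
  assumes "open S" "smooth_on S u" "smooth_on UNIV (G :: real \<Rightarrow> real)"
    and eq: "\<And>y. y \<in> S \<Longrightarrow> (\<Sum>k\<in>K. dderiv (q k) (dderiv (q k) u) y) = G (u y)"
    and x: "x \<in> S"
  shows "(\<Sum>k\<in>K. dderiv (q k) (dderiv (q k) (dderiv v u)) x) = deriv G (u x) * dderiv v u x"
    and "(\<Sum>k\<in>K. dderiv (q k) (dderiv (q k) (dderiv v (dderiv v u))) x)
      = deriv (deriv G) (u x) * (dderiv v u x)\<^sup>2 + deriv G (u x) * dderiv v (dderiv v u) x"
proof -
  have chain: "((\<lambda>y. g (u y)) has_derivative (\<lambda>v. g' * dderiv v u y)) (at y)"
    if "(g has_real_derivative g') (at (u y))" "y \<in> S" for g g' y
    using diff_chain_at[OF smooth_on_has_derivative[OF assms(2) that(2)] that(1)[unfolded has_field_derivative_def]]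
    by (simp add: o_def)
  have 1: "(\<Sum>k\<in>K. dderiv (q k) (dderiv (q k) (dderiv v u)) y) = deriv G (u y) * dderiv v u y"
    if "y \<in> S" for y v
    by (rule sum_second_dderiv_differentiate[OF assms(1,2) eq that])
      (use chain smooth_real_derivatives[OF assms(3)] that in auto)
  then show "(\<Sum>k\<in>K. dderiv (q k) (dderiv (q k) (dderiv v u)) x) = deriv G (u x) * dderiv v u x"
    using x by blast
  have "((\<lambda>y. deriv G (u y) * dderiv v u y) has_derivative
      (\<lambda>w. deriv G (u x) * dderiv w (dderiv v u) x + deriv (deriv G) (u x) * dderiv w u x * dderiv v u x)) (at x)"
    by (intro has_derivative_mult chain smooth_real_derivatives assms
        smooth_on_has_derivative[where S=S] smooth_on_dderiv)
  from sum_second_dderiv_differentiate[OF assms(1) smooth_on_dderiv[OF assms(2)] 1 x this, of v]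
  show "(\<Sum>k\<in>K. dderiv (q k) (dderiv (q k) (dderiv v (dderiv v u))) x)
      = deriv (deriv G) (u x) * (dderiv v u x)\<^sup>2 + deriv G (u x) * dderiv v (dderiv v u) x"
    by (simp add: power2_eq_square)
qed

section \<open>The lowest eigenvalue of the Hessian as a supersolution\<close>

text \<open>
The quadratic form of \<open>D\<^sup>2u - \<psi>\<close> is nonnegative near \<open>y\<close> and vanishes at \<open>y\<close> on \<open>e\<close>. Along the line
\<open>y + t q\<close> it is evaluated on the moving vector \<open>e + t w\<close>, and the conclusion is the second derivative test in
\<open>t\<close>. Choosing \<open>w\<close> freely takes the place of a perturbation formula for eigenvalues, so the lowest eigenvalue may
have any multiplicity.
\<close>

lemma touching_from_below_along_line:
  fixes u :: "'a::real_inner \<Rightarrow> real"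
  assumes "open S" "smooth_on S u" "y \<in> S"
    and below: "\<forall>\<^sub>F x in nhds y. \<forall>v. \<psi> x * (v \<bullet> v) \<le> dderiv v (dderiv v u) x"
    and touch: "dderiv e (dderiv e u) y = \<psi> y" and e: "e \<bullet> e = 1"
    and \<psi>1: "\<And>t. ((\<lambda>t. \<psi> (y + t *\<^sub>R q)) has_real_derivative \<psi>1 t) (at t)"
    and \<psi>2: "(\<psi>1 has_real_derivative \<psi>2) (at 0)"
  shows "0 \<le> (dderiv q (dderiv q (dderiv e (dderiv e u))) y - \<psi>2)
    + 4 * (dderiv q (dderiv w (dderiv e u)) y - \<psi>1 0 * (w \<bullet> e))
    + 2 * (dderiv w (dderiv w u) y - \<psi> y * (w \<bullet> w))"
proof -
  note sm = smooth_on_dderiv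
  define A where "A t = dderiv e (dderiv e u) (y + t *\<^sub>R q)" for t
  define B where "B t = dderiv w (dderiv e u) (y + t *\<^sub>R q)" for t
  define C where "C t = dderiv w (dderiv w u) (y + t *\<^sub>R q)" for t
  define A1 where "A1 t = dderiv q (dderiv e (dderiv e u)) (y + t *\<^sub>R q)" for t
  define B1 where "B1 t = dderiv q (dderiv w (dderiv e u)) (y + t *\<^sub>R q)" for t
  define C1 where "C1 t = dderiv q (dderiv w (dderiv w u)) (y + t *\<^sub>R q)" for t
  define p where "p t = \<psi> (y + t *\<^sub>R q)" for t
  define f where "f t = A t + 2 * t * B t + t\<^sup>2 * C t - p t * (1 + 2 * t * (w \<bullet> e) + t\<^sup>2 * (w \<bullet> w))" for t
  define f' where "f' t = A1 t + 2 * B t + 2 * t * B1 t + 2 * t * C t + t\<^sup>2 * C1 t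
    - \<psi>1 t * (1 + 2 * t * (w \<bullet> e) + t\<^sup>2 * (w \<bullet> w)) - p t * (2 * (w \<bullet> e) + 2 * t * (w \<bullet> w))" for t
  have line: "(A has_real_derivative A1 t) (at t)" "(B has_real_derivative B1 t) (at t)"
    "(C has_real_derivative C1 t) (at t)" if "y + t *\<^sub>R q \<in> S" for t
    unfolding A_def B_def C_def A1_def B1_def C1_def
    by (rule dderiv_line[where S=S], intro sm assms, rule that)+
  have y0: "y + 0 *\<^sub>R q \<in> S" using assms by simp
  have line0: "(A1 has_real_derivative dderiv q (dderiv q (dderiv e (dderiv e u))) y) (at 0)"
    "(B1 has_real_derivative dderiv q (dderiv q (dderiv w (dderiv e u))) y) (at 0)"
    "(C1 has_real_derivative dderiv q (dderiv q (dderiv w (dderiv w u))) y) (at 0)"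
    unfolding A1_def B1_def C1_def
    using dderiv_line[OF sm[OF sm[OF sm[OF assms(2)]]] y0] by simp_all
  have p1: "(p has_real_derivative \<psi>1 t) (at t)" for t unfolding p_def by (rule \<psi>1)
  have "0 \<le> dderiv q (dderiv q (dderiv e (dderiv e u))) y + 4 * B1 0 + 2 * C 0
    - \<psi>2 - 4 * \<psi>1 0 * (w \<bullet> e) - 2 * p 0 * (w \<bullet> w)"
  proof (rule second_derivative_test(2))
    show "\<forall>\<^sub>F t in nhds 0. (f has_real_derivative f' t) (at t)"
      using eventually_line_in_open[OF assms(1,3), of q]
    proof eventually_elim
      case (elim t)
      show ?case unfolding f_def f'_def
        by (rule derivative_eq_intros line[OF elim] p1 refl)+ (simp add: algebra_simps power2_eq_square)
    qed
    show "(f' has_real_derivative dderiv q (dderiv q (dderiv e (dderiv e u))) y + 4 * B1 0 + 2 * C 0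
      - \<psi>2 - 4 * \<psi>1 0 * (w \<bullet> e) - 2 * p 0 * (w \<bullet> w)) (at 0)"
      unfolding f'_def
      by (rule derivative_eq_intros line[OF y0] line0 p1 \<psi>2 refl)+ (simp add: algebra_simps)
    have f0: "f 0 = 0" using touch by (simp add: f_def A_def p_def)
    obtain U where U: "open U" "y \<in> U" "\<And>x v. x \<in> U \<Longrightarrow> \<psi> x * (v \<bullet> v) \<le> dderiv v (dderiv v u) x"
      using below by (auto simp: eventually_nhds)
    show "\<forall>\<^sub>F t in nhds 0. f 0 \<le> f t"
      using eventually_line_in_open[OF assms(1,3), of q] eventually_line_in_open[OF U(1,2), of q]
    proof eventually_elim
      case (elim t)
      have "(e + t *\<^sub>R w) \<bullet> (e + t *\<^sub>R w) = 1 + 2 * t * (w \<bullet> e) + t\<^sup>2 * (w \<bullet> w)"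
        by (simp add: inner_simps e inner_commute power2_eq_square)
      then have "f t = dderiv (e + t *\<^sub>R w) (dderiv (e + t *\<^sub>R w) u) (y + t *\<^sub>R q)
          - \<psi> (y + t *\<^sub>R q) * ((e + t *\<^sub>R w) \<bullet> (e + t *\<^sub>R w))"
        using second_dderiv_expand[OF assms(1,2) elim(1), of e t w]
        by (simp add: f_def A_def B_def C_def p_def)
      with U(3)[OF elim(2), of "e + t *\<^sub>R w"] f0 show ?case by simp
    qed
  qed
  then show ?thesis by (simp add: B1_def C_def p_def algebra_simps)
qed

text \<open>
In the viscosity sense the lowest eigenvalue \<open>\<lambda>\<close> of the Hessian satisfies \<open>\<Delta>\<lambda> \<le> C |\<nabla>\<lambda>|\<close>,
an inequality without a zeroth-order term. The vectors \<open>w = \<tau> e\<^sub>k\<close> are chosen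
because the resulting third derivatives sum to \<open>\<Delta>(u\<^sub>e)\<close> and the resulting second derivatives to \<open>\<Delta>u\<close>, both of
which the equation controls. The term \<open>G' \<lambda>\<close> that remains is
nonpositive.
\<close>

lemma lowest_eigenvalue_supersolution:
  fixes u :: "real ^ 'n \<Rightarrow> real" and G :: "real \<Rightarrow> real"
  assumes "open S" "smooth_on S u" "smooth_on UNIV G" "y \<in> S"
    and eq: "\<And>x. x \<in> S \<Longrightarrow> (\<Sum>k\<in>UNIV. dderiv (axis k 1) (dderiv (axis k 1) u) x) = G (u x)"
    and G: "G (u y) > 0" "deriv G (u y) < 0" "G (u y) * deriv (deriv G) (u y) \<le> 2 * (deriv G (u y))\<^sup>2"
    and below: "\<forall>\<^sub>F x in nhds y. \<forall>v. \<psi> x * (v \<bullet> v) \<le> dderiv v (dderiv v u) x"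
    and touch: "dderiv e (dderiv e u) y = \<psi> y" and e: "e \<bullet> e = 1" and nonneg: "0 \<le> \<psi> y"
    and \<psi>1: "\<And>k t. ((\<lambda>t. \<psi> (y + t *\<^sub>R axis k 1)) has_real_derivative \<psi>1 k t) (at t)"
    and \<psi>2: "\<And>k. (\<psi>1 k has_real_derivative \<psi>2 k) (at 0)"
  shows "(\<Sum>k\<in>UNIV. \<psi>2 k) \<le> 4 * (deriv G (u y) * dderiv e u y / G (u y)) * (\<Sum>k\<in>UNIV. \<psi>1 k 0 * e $ k)"
proof -
  let ?G = "G (u y)" and ?G' = "deriv G (u y)" and ?G'' = "deriv (deriv G) (u y)"
  \<comment> \<open>The minimiser of the quadratic polynomial \<open>4 \<tau> G' u\<^sub>e + 2 \<tau>\<^sup>2 G\<close>, whose minimum is \<open>- 2 G'\<^sup>2 u\<^sub>e\<^sup>2 / G\<close>.\<close>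
  define \<tau> where "\<tau> = - (?G' * dderiv e u y / ?G)"
  define D where "D k = dderiv (axis k (1::real) :: real ^ 'n)" for k
  have sums: "(\<Sum>k\<in>UNIV. D k (D k (dderiv e u)) y) = ?G' * dderiv e u y"
    "(\<Sum>k\<in>UNIV. D k (D k (dderiv e (dderiv e u))) y) = ?G'' * (dderiv e u y)\<^sup>2 + ?G' * \<psi> y"
    unfolding D_def touch[symmetric]
    by (rule semilinear_differentiated[OF assms(1-3) eq \<open>y \<in> S\<close>], assumption)+
  have tr: "(\<Sum>k\<in>UNIV. D k (D k u) y) = ?G" unfolding D_def by (rule eq[OF \<open>y \<in> S\<close>])
  have line: "0 \<le> (D k (D k (dderiv e (dderiv e u))) y - \<psi>2 k)
      + 4 * \<tau> * (D k (D k (dderiv e u)) y - \<psi>1 k 0 * e $ k) + 2 * \<tau>\<^sup>2 * (D k (D k u) y - \<psi> y)" for k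
  proof -
    have "dderiv (axis k 1) (dderiv (\<tau> *\<^sub>R axis k 1) (dderiv e u)) y = \<tau> * D k (D k (dderiv e u)) y"
      unfolding D_def by (rule dderiv_dderiv_scale[OF assms(1) smooth_on_dderiv[OF assms(2)] assms(4)])
    moreover have "dderiv (\<tau> *\<^sub>R axis k 1) (dderiv (\<tau> *\<^sub>R axis k 1) u) y = \<tau>\<^sup>2 * D k (D k u) y"
      unfolding D_def dderiv_dderiv_scale[OF assms(1,2,4)]
        dderiv_scale_left[OF smooth_on_dderiv[OF assms(2)] assms(4)]
      by (simp add: power2_eq_square)
    moreover have "(\<tau> *\<^sub>R axis k 1) \<bullet> e = \<tau> * e $ k"
      "(\<tau> *\<^sub>R axis k 1 :: real ^ 'n) \<bullet> (\<tau> *\<^sub>R axis k 1) = \<tau>\<^sup>2"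
      by (simp_all add: inner_axis' power2_eq_square)
    moreover note touching_from_below_along_line[OF assms(1,2,4) below touch e \<psi>1 \<psi>2, of k "\<tau> *\<^sub>R axis k 1"]
    ultimately show ?thesis
      by (simp only: D_def right_diff_distrib mult.assoc mult.commute mult.left_commute)
  qed
  have "0 \<le> (\<Sum>k\<in>UNIV. (D k (D k (dderiv e (dderiv e u))) y - \<psi>2 k)
      + 4 * \<tau> * (D k (D k (dderiv e u)) y - \<psi>1 k 0 * e $ k) + 2 * \<tau>\<^sup>2 * (D k (D k u) y - \<psi> y))"
    by (rule sum_nonneg) (rule line)
  also have "\<dots> = (?G'' * (dderiv e u y)\<^sup>2 + ?G' * \<psi> y - (\<Sum>k\<in>UNIV. \<psi>2 k))
      + 4 * \<tau> * (?G' * dderiv e u y - (\<Sum>k\<in>UNIV. \<psi>1 k 0 * e $ k))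
      + 2 * \<tau>\<^sup>2 * (?G - real CARD('n) * \<psi> y)"
    by (simp add: sum.distrib sum_subtractf sum_distrib_left[symmetric] sums tr)
  finally have main: "0 \<le> \<dots>" .
  have a: "\<tau>\<^sup>2 * ?G = - \<tau> * (?G' * dderiv e u y)"
    using G(1) by (simp add: \<tau>_def power2_eq_square)
  have "?G'' * (dderiv e u y)\<^sup>2 \<le> 2 * \<tau>\<^sup>2 * ?G"
  proof -
    have "?G'' \<le> 2 * ?G'\<^sup>2 / ?G" using G(1,3) by (simp add: field_simps)
    then have "?G'' * (dderiv e u y)\<^sup>2 \<le> (2 * ?G'\<^sup>2 / ?G) * (dderiv e u y)\<^sup>2"
      by (rule mult_right_mono) simp
    also have "\<dots> = 2 * \<tau>\<^sup>2 * ?G" using G(1) by (simp add: \<tau>_def power2_eq_square field_simps)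
    finally show ?thesis .
  qed
  moreover have "?G' * \<psi> y \<le> 0" using G(2) nonneg by (simp add: mult_nonpos_nonneg)
  moreover have "0 \<le> \<tau>\<^sup>2 * (real CARD('n) * \<psi> y)" using nonneg by simp
  ultimately have "(\<Sum>k\<in>UNIV. \<psi>2 k) \<le> - 4 * \<tau> * (\<Sum>k\<in>UNIV. \<psi>1 k 0 * e $ k)"
    using main a by (simp add: algebra_simps)
  then show ?thesis by (simp add: \<tau>_def)
qed

section \<open>Strong minimum principle for the lowest eigenvalue\<close>

lemma gaussian_along_axis:
  fixes z :: "real ^ 'n"
  shows "((\<lambda>t. exp (- \<alpha> * (norm (z + t *\<^sub>R axis k 1))\<^sup>2)) has_real_derivative
      - 2 * \<alpha> * (z $ k + t) * exp (- \<alpha> * (norm (z + t *\<^sub>R axis k 1))\<^sup>2)) (at t)"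
    and "((\<lambda>t. - 2 * \<alpha> * (z $ k + t) * exp (- \<alpha> * (norm (z + t *\<^sub>R axis k 1))\<^sup>2)) has_real_derivative
      (4 * \<alpha>\<^sup>2 * (z $ k)\<^sup>2 - 2 * \<alpha>) * exp (- \<alpha> * (norm z)\<^sup>2)) (at 0)"
proof -
  have n: "(norm (z + t *\<^sub>R axis k 1))\<^sup>2 = (norm z)\<^sup>2 + 2 * t * z $ k + t\<^sup>2" for t
    unfolding power2_norm_eq_inner
    by (simp add: inner_simps inner_axis inner_axis' power2_eq_square algebra_simps)
  show 1: "((\<lambda>t. exp (- \<alpha> * (norm (z + t *\<^sub>R axis k 1))\<^sup>2)) has_real_derivative
      - 2 * \<alpha> * (z $ k + t) * exp (- \<alpha> * (norm (z + t *\<^sub>R axis k 1))\<^sup>2)) (at t)" for t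
    unfolding n by (rule derivative_eq_intros refl)+ (simp add: algebra_simps)
  show "((\<lambda>t. - 2 * \<alpha> * (z $ k + t) * exp (- \<alpha> * (norm (z + t *\<^sub>R axis k 1))\<^sup>2)) has_real_derivative
      (4 * \<alpha>\<^sup>2 * (z $ k)\<^sup>2 - 2 * \<alpha>) * exp (- \<alpha> * (norm z)\<^sup>2)) (at 0)"
    by (rule derivative_eq_intros 1 refl)+ (simp add: power2_eq_square algebra_simps)
qed

text \<open>
The constant of the gradient term in \<open>lowest_eigenvalue_supersolution\<close> is locally uniform in the point and in
the unit vector.
\<close>

lemma gradient_coefficient_bound:
  fixes u :: "real ^ 'n \<Rightarrow> real" and G :: "real \<Rightarrow> real"
  assumes "smooth_on S u" "smooth_on UNIV G" "compact C" "C \<subseteq> S" "\<And>x. x \<in> C \<Longrightarrow> G (u x) > 0"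
  obtains K where "K \<ge> 0"
    "\<And>x e. x \<in> C \<Longrightarrow> norm e = 1 \<Longrightarrow> \<bar>4 * (deriv G (u x) * dderiv e u x / G (u x))\<bar> \<le> K"
proof -
  define k where "k x = \<bar>4 * deriv G (u x) / G (u x)\<bar> * (\<Sum>i\<in>UNIV. \<bar>dderiv (axis i 1) u x\<bar>)" for x
  have cu: "continuous_on C u" "continuous_on C (dderiv v u)" for v
    using smooth_on_continuous_on[OF assms(1)] smooth_on_continuous_on[OF smooth_on_dderiv[OF assms(1)]]
      assms(4) continuous_on_subset by blast+
  have cG: "continuous_on UNIV G" "continuous_on UNIV (deriv G)"
    using smooth_real_derivatives[OF assms(2)] DERIV_continuous_on by blast+
  have "continuous_on C k"
    unfolding k_def
    by (intro continuous_intros cu continuous_on_compose2[OF cG(1)] continuous_on_compose2[OF cG(2)])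
      (use assms(5) in \<open>auto simp: less_imp_neq[THEN not_sym]\<close>)
  then have "bounded (k ` C)"
    using assms(3) compact_continuous_image compact_imp_bounded by blast
  then obtain K where K: "K > 0" "\<And>x. x \<in> C \<Longrightarrow> \<bar>k x\<bar> \<le> K"
    unfolding bounded_pos by auto
  show ?thesis
  proof (rule that[of K])
    fix x and e :: "real ^ 'n" assume x: "x \<in> C" and e: "norm e = 1"
    have "e = (\<Sum>i\<in>UNIV. e $ i *\<^sub>R axis i 1)"
      using basis_expansion[of e] by (simp add: scalar_mult_eq_scaleR)
    then have "dderiv e u x = (\<Sum>i\<in>UNIV. e $ i * dderiv (axis i 1) u x)"
      using dderiv_sum_left[OF assms(1), of x "\<lambda>i. e $ i" "\<lambda>i. axis i 1" UNIV] x assms(4) by auto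
    also have "\<bar>\<dots>\<bar> \<le> (\<Sum>i\<in>UNIV. \<bar>e $ i * dderiv (axis i 1) u x\<bar>)" by (rule sum_abs)
    also have "\<dots> \<le> (\<Sum>i\<in>UNIV. \<bar>dderiv (axis i 1) u x\<bar>)"
      using component_le_norm_cart[of e] e by (intro sum_mono) (simp add: abs_mult mult_left_le_one_le)
    finally have "\<bar>dderiv e u x\<bar> \<le> (\<Sum>i\<in>UNIV. \<bar>dderiv (axis i 1) u x\<bar>)" .
    then have "\<bar>4 * deriv G (u x) / G (u x)\<bar> * \<bar>dderiv e u x\<bar> \<le> k x"
      unfolding k_def by (rule mult_left_mono) simp
    then show "\<bar>4 * (deriv G (u x) * dderiv e u x / G (u x))\<bar> \<le> K"
      using K(2)[OF x] by (simp add: abs_mult)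
  qed (use K in simp)
qed

text \<open>
The Hopf argument. On the closed ball of radius \<open>R\<close> about \<open>x0\<close> the Hessian is positive definite except at the
boundary point \<open>z\<close>. On the boundary of a small ball about \<open>z\<close> the lowest eigenvalue lies above a small multiple
of the barrier \<open>h = exp(-\<alpha> |x - x0|\<^sup>2) - exp(-\<alpha> R\<^sup>2)\<close>, while the two agree at \<open>z\<close>. Hence this
multiple, lowered by a constant, touches the lowest eigenvalue from below at an interior point \<open>y\<close>, where for large \<open>\<alpha>\<close>
the Laplacian of the barrier is too large for \<open>lowest_eigenvalue_supersolution\<close>. Minimising over pairs of a point
and a unit vector produces \<open>y\<close> and the eigenvector at the same time.
\<close>

lemma no_interior_tangent_ball:
  fixes u :: "real ^ 'n \<Rightarrow> real" and G :: "real \<Rightarrow> real"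
  assumes "open S" "smooth_on S u" "smooth_on UNIV G"
    and eq: "\<And>x. x \<in> S \<Longrightarrow> (\<Sum>k\<in>UNIV. dderiv (axis k 1) (dderiv (axis k 1) u) x) = G (u x)"
    and G: "\<And>x. x \<in> S \<Longrightarrow> G (u x) > 0" "\<And>x. x \<in> S \<Longrightarrow> deriv G (u x) < 0"
      "\<And>x. x \<in> S \<Longrightarrow> G (u x) * deriv (deriv G) (u x) \<le> 2 * (deriv G (u x))\<^sup>2"
    and psd: "\<And>x v. x \<in> S \<Longrightarrow> 0 \<le> dderiv v (dderiv v u) x"
    and R: "0 < R" "dist z x0 = R" and z: "z \<in> S" "norm e0 = 1" "dderiv e0 (dderiv e0 u) z = 0"
    and pd: "\<And>x v. \<lbrakk>x \<in> S; dist x x0 \<le> R; x \<noteq> z; norm v = 1\<rbrakk> \<Longrightarrow> 0 < dderiv v (dderiv v u) x"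
  shows False
proof -
  obtain r0 where r0: "r0 > 0" "cball z r0 \<subseteq> S"
    using assms(1) z(1) open_contains_cball by blast
  \<comment> \<open>Within \<open>cball z r\<close> the distance to \<open>x0\<close> stays between \<open>R/2\<close> and \<open>2 R\<close>, away from the centre where the barrier is not subharmonic.\<close>
  define r where "r = min r0 (R / 2)"
  have r: "0 < r" "r \<le> R / 2" "cball z r \<subseteq> S" using r0 R by (auto simp: r_def)
  obtain K where K: "K \<ge> 0"
    "\<And>x e. x \<in> cball z r \<Longrightarrow> norm e = 1 \<Longrightarrow> \<bar>4 * (deriv G (u x) * dderiv e u x / G (u x))\<bar> \<le> K"
    by (rule gradient_coefficient_bound[OF assms(2,3) compact_cball r(3)]) (use G r in auto)
  \<comment> \<open>Since \<open>\<alpha> R\<^sup>2 / 2 > n + 2 K R\<close>, one has \<open>2 \<alpha> d\<^sup>2 > n + K d\<close> for every distance \<open>d\<close> in \<open>[R/2, 2 R]\<close>.\<close>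
  define \<alpha> where "\<alpha> = 2 * (real CARD('n) + 2 * K * R) / R\<^sup>2 + 1"
  have \<alpha>: "\<alpha> > 0" using K(1) R(1) by (simp add: \<alpha>_def add_nonneg_pos)
  define h where "h x = exp (- \<alpha> * (norm (x - x0))\<^sup>2) - exp (- \<alpha> * R\<^sup>2)" for x
  define F where "F p = dderiv (snd p) (dderiv (snd p) u) (fst p)" for p :: "(real ^ 'n) \<times> (real ^ 'n)"
  have contF: "continuous_on (C \<times> sphere 0 1) F" if "C \<subseteq> S" for C
    using continuous_on_subset[OF continuous_on_hessian_form[OF assms(1,2) that], of "C \<times> sphere 0 1"]
    by (auto simp: F_def case_prod_unfold)
  have conth: "continuous_on A h" for A unfolding h_def by (intro continuous_intros)
  have ne: "sphere (0 :: real ^ 'n) 1 \<noteq> {}" using z(2) by (auto intro: exI[of _ e0])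
  \<comment> \<open>The part of the small sphere where the barrier is nonnegative; it is compact and misses \<open>z\<close>.\<close>
  define L where "L = sphere z r \<inter> cball x0 R"
  obtain \<mu> where \<mu>: "\<mu> > 0" "\<And>x v. x \<in> L \<Longrightarrow> norm v = 1 \<Longrightarrow> \<mu> \<le> F (x, v)"
  proof (cases "L = {}")
    case True then show ?thesis using that[of 1] by simp
  next
    case False
    have "L \<subseteq> S" using r(3) by (auto simp: L_def)
    moreover have "compact (L \<times> sphere (0 :: real ^ 'n) 1)"
      by (intro compact_Times) (auto simp: L_def intro: compact_Int_closed)
    moreover have "L \<times> sphere (0 :: real ^ 'n) 1 \<noteq> {}" using False ne by blast
    ultimately obtain p where p: "p \<in> L \<times> sphere 0 1" "\<And>q. q \<in> L \<times> sphere 0 1 \<Longrightarrow> F p \<le> F q"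
      using continuous_attains_inf[of "L \<times> sphere 0 1" F] contF[of L] by blast
    have "fst p \<in> S" "dist (fst p) x0 \<le> R" "fst p \<noteq> z" "norm (snd p) = 1"
      using p(1) \<open>L \<subseteq> S\<close> r(1) by (auto simp: L_def dist_commute)
    then have "0 < F p" unfolding F_def by (rule pd)
    then show ?thesis using p(2) by (intro that[of "F p"]) auto
  qed
  define \<epsilon> where "\<epsilon> = \<mu> / 2"
  have \<epsilon>: "\<epsilon> > 0" using \<mu> by (simp add: \<epsilon>_def)
  let ?P = "cball z r \<times> sphere (0 :: real ^ 'n) 1"
  define \<Phi> where "\<Phi> p = F p - \<epsilon> * h (fst p)" for p
  have "continuous_on ?P \<Phi>"
    unfolding \<Phi>_def
    by (intro continuous_intros contF r(3) continuous_on_compose2[OF conth[of UNIV]]) auto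
  moreover have "compact ?P" by (intro compact_Times) auto
  moreover have zP: "(z, e0) \<in> ?P" using r(1) z(2) by simp
  ultimately obtain p where p: "p \<in> ?P" "\<And>q. q \<in> ?P \<Longrightarrow> \<Phi> p \<le> \<Phi> q"
    using continuous_attains_inf[of ?P \<Phi>] by blast
  obtain y e where pe: "p = (y, e)" by (cases p)
  define m where "m = \<Phi> p"
  have "h z = 0" using R(2) by (simp add: h_def dist_norm)
  then have m: "m \<le> 0" using p(2)[OF zP] z(3) by (simp add: m_def \<Phi>_def F_def)
  have ye: "y \<in> cball z r" "norm e = 1" using p(1) pe by auto
  have yS: "y \<in> S" using ye r by auto
  have "dist z y \<noteq> r"
  proof
    assume d: "dist z y = r"
    show False
    proof (cases "dist x0 y \<le> R")
      case True
      then have "\<mu> \<le> F (y, e)" using \<mu>(2) ye d by (simp add: L_def)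
      moreover have "\<epsilon> * h y \<le> \<epsilon>"
      proof -
        have "exp (- \<alpha> * (norm (y - x0))\<^sup>2) \<le> 1" using \<alpha> by simp
        moreover have "0 < exp (- \<alpha> * R\<^sup>2)" by simp
        ultimately have "h y \<le> 1" unfolding h_def by linarith
        then show ?thesis using \<epsilon> by simp
      qed
      moreover have "F (y, e) \<le> \<epsilon> * h y" using m by (simp add: m_def \<Phi>_def pe)
      moreover have "\<epsilon> < \<mu>" using \<mu>(1) by (simp add: \<epsilon>_def)
      ultimately show False by linarith
    next
      case False
      then have "R\<^sup>2 < (norm (y - x0))\<^sup>2" using R(1)
        by (intro power_strict_mono) (auto simp: dist_norm norm_minus_commute)
      then have "h y < 0" using \<alpha> by (simp add: h_def)
      then have "\<epsilon> * h y < 0" using \<epsilon> by (simp add: mult_pos_neg)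
      moreover have "0 \<le> F (y, e)" using psd yS by (simp add: F_def)
      ultimately show False using m by (simp add: m_def \<Phi>_def pe)
    qed
  qed
  then have yball: "y \<in> ball z r" using ye by simp
  define \<psi> where "\<psi> x = \<epsilon> * h x + m" for x
  define w where "w = y - x0"
  define E where "E = exp (- \<alpha> * (norm w)\<^sup>2)"
  have touch: "dderiv e (dderiv e u) y = \<psi> y"
    by (simp add: \<psi>_def m_def \<Phi>_def pe F_def)
  have below: "\<forall>\<^sub>F x in nhds y. \<forall>v. \<psi> x * (v \<bullet> v) \<le> dderiv v (dderiv v u) x"
    using eventually_nhds_in_open[OF open_ball yball]
  proof eventually_elim
    case (elim x)
    have xS: "x \<in> S" using elim r by auto
    show ?case
    proof
      fix v :: "real ^ 'n"
      show "\<psi> x * (v \<bullet> v) \<le> dderiv v (dderiv v u) x"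
      proof (cases "v = 0")
        case True
        then show ?thesis using psd[OF xS, of 0] by simp
      next
        case False
        define s where "s = sgn v"
        have s: "norm s = 1" "v = norm v *\<^sub>R s" using False by (simp_all add: s_def norm_sgn sgn_div_norm)
        have "\<psi> x \<le> dderiv s (dderiv s u) x"
          using p(2)[of "(x, s)"] elim s(1) by (simp add: \<psi>_def m_def \<Phi>_def F_def)
        then have "\<psi> x * (norm v)\<^sup>2 \<le> (norm v)\<^sup>2 * dderiv s (dderiv s u) x"
          using mult_right_mono[of "\<psi> x" "dderiv s (dderiv s u) x" "(norm v)\<^sup>2"] by (simp add: mult.commute)
        also have "\<dots> = dderiv (norm v *\<^sub>R s) (dderiv (norm v *\<^sub>R s) u) x"
          by (simp only: dderiv_dderiv_scale[OF assms(1,2) xS]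
              dderiv_scale_left[OF smooth_on_dderiv[OF assms(2)] xS] power2_eq_square mult.assoc)
        finally show ?thesis using s(2) by (simp add: power2_norm_eq_inner)
      qed
    qed
  qed
  have \<psi>1: "((\<lambda>t. \<psi> (y + t *\<^sub>R axis k 1)) has_real_derivative
      \<epsilon> * (- 2 * \<alpha> * (w $ k + t) * exp (- \<alpha> * (norm (w + t *\<^sub>R axis k 1))\<^sup>2))) (at t)" for k t
  proof -
    have "y + t *\<^sub>R axis k 1 - x0 = w + t *\<^sub>R axis k 1" for t by (simp add: w_def)
    then have eq: "\<psi> (y + t *\<^sub>R axis k 1)
        = \<epsilon> * (exp (- \<alpha> * (norm (w + t *\<^sub>R axis k 1))\<^sup>2) - exp (- \<alpha> * R\<^sup>2)) + m" for t
      by (simp only: \<psi>_def h_def)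
    have "((\<lambda>t. \<epsilon> * (exp (- \<alpha> * (norm (w + t *\<^sub>R axis k 1))\<^sup>2) - exp (- \<alpha> * R\<^sup>2)) + m)
        has_real_derivative
        \<epsilon> * (- 2 * \<alpha> * (w $ k + t) * exp (- \<alpha> * (norm (w + t *\<^sub>R axis k 1))\<^sup>2) - 0) + 0) (at t)"
      by (intro DERIV_add DERIV_cmult DERIV_diff gaussian_along_axis DERIV_const)
    then show ?thesis by (simp only: eq diff_zero add_0_right)
  qed
  have \<psi>2: "((\<lambda>t. \<epsilon> * (- 2 * \<alpha> * (w $ k + t) * exp (- \<alpha> * (norm (w + t *\<^sub>R axis k 1))\<^sup>2)))
      has_real_derivative \<epsilon> * ((4 * \<alpha>\<^sup>2 * (w $ k)\<^sup>2 - 2 * \<alpha>) * E)) (at 0)" for k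
    unfolding E_def by (intro DERIV_cmult gaussian_along_axis)
  have nonneg: "0 \<le> \<psi> y" using psd[OF yS, of e] touch by simp
  have ee: "e \<bullet> e = 1" using ye(2) by (simp add: dot_square_norm)
  define \<beta> where "\<beta> = 4 * (deriv G (u y) * dderiv e u y / G (u y))"
  have "(\<Sum>k\<in>UNIV. \<epsilon> * ((4 * \<alpha>\<^sup>2 * (w $ k)\<^sup>2 - 2 * \<alpha>) * E)) \<le> \<beta> *
      (\<Sum>k\<in>UNIV. \<epsilon> * (- 2 * \<alpha> * (w $ k + 0) * exp (- \<alpha> * (norm (w + 0 *\<^sub>R axis k 1))\<^sup>2)) * e $ k)"
    unfolding \<beta>_def
    by (rule lowest_eigenvalue_supersolution[OF assms(1-3) yS eq G(1-3)[OF yS] below touch ee nonneg \<psi>1 \<psi>2])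
  moreover have "(\<Sum>k\<in>UNIV. \<epsilon> * ((4 * \<alpha>\<^sup>2 * (w $ k)\<^sup>2 - 2 * \<alpha>) * E))
      = (2 * \<alpha> * \<epsilon> * E) * (2 * \<alpha> * (norm w)\<^sup>2 - real CARD('n))"
  proof -
    have "(\<Sum>k\<in>UNIV. \<epsilon> * ((4 * \<alpha>\<^sup>2 * (w $ k)\<^sup>2 - 2 * \<alpha>) * E))
        = (\<Sum>k\<in>UNIV. (2 * \<alpha> * \<epsilon> * E) * (2 * \<alpha> * (w $ k)\<^sup>2 - 1))"
      by (rule sum.cong) (simp_all add: power2_eq_square algebra_simps)
    also have "\<dots> = (2 * \<alpha> * \<epsilon> * E) * (2 * \<alpha> * (\<Sum>k\<in>UNIV. (w $ k)\<^sup>2) - real CARD('n))"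
      by (simp add: sum_subtractf sum_distrib_left[symmetric])
    also have "(\<Sum>k\<in>UNIV. (w $ k)\<^sup>2) = (norm w)\<^sup>2"
      unfolding power2_norm_eq_inner inner_vec_def by (simp add: power2_eq_square)
    finally show ?thesis .
  qed
  moreover have "(\<Sum>k\<in>UNIV. \<epsilon> * (- 2 * \<alpha> * (w $ k + 0) * exp (- \<alpha> * (norm (w + 0 *\<^sub>R axis k 1))\<^sup>2)) * e $ k)
      = (2 * \<alpha> * \<epsilon> * E) * - (w \<bullet> e)"
  proof -
    have "(\<Sum>k\<in>UNIV. \<epsilon> * (- 2 * \<alpha> * (w $ k + 0) * exp (- \<alpha> * (norm (w + 0 *\<^sub>R axis k 1))\<^sup>2)) * e $ k)
        = (\<Sum>k\<in>UNIV. - (2 * \<alpha> * \<epsilon> * E) * (w $ k * e $ k))"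
      by (rule sum.cong) (simp_all add: E_def)
    then show ?thesis by (simp add: inner_vec_def sum_distrib_left[symmetric] sum_negf)
  qed
  ultimately have "(2 * \<alpha> * \<epsilon> * E) * (2 * \<alpha> * (norm w)\<^sup>2 - real CARD('n)) \<le> (2 * \<alpha> * \<epsilon> * E) * (\<beta> * - (w \<bullet> e))"
    by (simp add: mult_ac)
  moreover have "0 < 2 * \<alpha> * \<epsilon> * E" using \<alpha> \<epsilon> by (simp add: E_def)
  ultimately have "2 * \<alpha> * (norm w)\<^sup>2 - real CARD('n) \<le> \<beta> * - (w \<bullet> e)"
    using mult_le_cancel_left_pos by blast
  also have "\<dots> \<le> \<bar>\<beta>\<bar> * \<bar>w \<bullet> e\<bar>" by (metis abs_ge_self abs_minus_cancel abs_mult)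
  also have "\<dots> \<le> K * norm w"
    using K(2)[OF ye] Cauchy_Schwarz_ineq2[of w e] ye(2) K(1) unfolding \<beta>_def
    by (intro mult_mono) auto
  finally have up: "2 * \<alpha> * (norm w)\<^sup>2 \<le> real CARD('n) + K * norm w" by simp
  have w: "R / 2 \<le> norm w" "norm w \<le> 2 * R"
    using dist_triangle[of z x0 y] dist_triangle[of y x0 z] R ye(1) r(2)
    by (auto simp: w_def dist_norm[symmetric] dist_commute)
  have "2 * \<alpha> * (R / 2)\<^sup>2 \<le> 2 * \<alpha> * (norm w)\<^sup>2"
    using w(1) R(1) \<alpha> by (intro mult_left_mono power_mono) auto
  also note up
  also have "K * norm w \<le> 2 * K * R" using mult_left_mono[OF w(2) K(1)] by simp
  finally have "\<alpha> * R\<^sup>2 \<le> 2 * (real CARD('n) + 2 * K * R)" by (simp add: power2_eq_square algebra_simps)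
  moreover have "\<alpha> * R\<^sup>2 = 2 * (real CARD('n) + 2 * K * R) + R\<^sup>2"
    using R(1) by (simp add: \<alpha>_def field_simps)
  ultimately show False using R(1) by simp
qed

text \<open>
The degenerate set \<open>Z\<close> is closed in \<open>S\<close>. If it were not open, some point \<open>x1\<close> outside \<open>Z\<close> would be much closer
to \<open>Z\<close> than to the boundary of \<open>S\<close>. With \<open>z\<close> a nearest point of \<open>Z\<close>, the ball with diameter from \<open>x1\<close> to \<open>z\<close>
meets \<open>Z\<close> in \<open>z\<close> only, contrary to \<open>no_interior_tangent_ball\<close>.
\<close>

lemma degenerate_set_propagates:
  fixes u :: "real ^ 'n \<Rightarrow> real" and G :: "real \<Rightarrow> real"
  assumes "open S" "connected S" "smooth_on S u" "smooth_on UNIV G"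
    and eq: "\<And>x. x \<in> S \<Longrightarrow> (\<Sum>k\<in>UNIV. dderiv (axis k 1) (dderiv (axis k 1) u) x) = G (u x)"
    and G: "\<And>x. x \<in> S \<Longrightarrow> G (u x) > 0" "\<And>x. x \<in> S \<Longrightarrow> deriv G (u x) < 0"
      "\<And>x. x \<in> S \<Longrightarrow> G (u x) * deriv (deriv G) (u x) \<le> 2 * (deriv G (u x))\<^sup>2"
    and psd: "\<And>x v. x \<in> S \<Longrightarrow> 0 \<le> dderiv v (dderiv v u) x"
    and p: "p \<in> S" "det (hessian u p) = 0" and x: "x \<in> S"
  shows "det (hessian u x) = 0"
proof -
  define Z where "Z = {x \<in> S. det (hessian u x) = 0}"
  note Ziff = det_hessian_zero_iff[OF assms(1,3) _ psd]
  have closed: "closedin (top_of_set S) Z"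
    using continuous_closedin_preimage_constant[OF continuous_on_det_hessian[OF assms(3)], of 0]
    by (simp add: Z_def)
  then obtain C where C: "closed C" "Z = S \<inter> C" by (auto simp: closedin_closed)
  have "open Z"
    unfolding open_contains_ball
  proof
    fix z1 assume z1: "z1 \<in> Z"
    obtain \<delta> where \<delta>: "\<delta> > 0" "ball z1 \<delta> \<subseteq> S"
      using assms(1) z1 unfolding open_contains_ball Z_def by blast
    have "ball z1 (\<delta> / 3) \<subseteq> Z"
    proof (rule ccontr)
      assume "\<not> ball z1 (\<delta> / 3) \<subseteq> Z"
      then obtain x1 where "x1 \<in> ball z1 (\<delta> / 3)" "x1 \<notin> Z" by blast
      then have x1: "dist z1 x1 < \<delta> / 3" "x1 \<notin> Z" by simp_all
      define B where "B = cball z1 (2 * \<delta> / 3)"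
      have BS: "B \<subseteq> S" using \<delta> by (force simp: B_def)
      have "Z \<inter> B = B \<inter> C" using C(2) BS by auto
      then have "compact (Z \<inter> B)" using C(1) by (simp add: B_def compact_Int_closed)
      moreover have z1B: "z1 \<in> Z \<inter> B" using z1 \<delta> by (simp add: B_def)
      ultimately obtain z where z: "z \<in> Z \<inter> B" "\<And>y. y \<in> Z \<inter> B \<Longrightarrow> dist x1 z \<le> dist x1 y"
        using distance_attains_inf[of "Z \<inter> B" x1] compact_imp_closed by blast
      have nearest: "dist x1 z \<le> dist x1 y" if "y \<in> Z" for y
      proof (cases "y \<in> B")
        case True then show ?thesis using z(2) that by blast
      next
        case False
        then have "dist x1 z1 \<le> dist x1 y"
          using x1(1) dist_triangle[of z1 y x1] by (simp add: B_def dist_commute)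
        then show ?thesis using z(2)[OF z1B] by simp
      qed
      have d: "dist x1 z > 0" using z(1) x1(2) by auto
      have x1S: "x1 \<in> S" using x1(1) \<delta> by auto
      obtain e0 where e0: "norm e0 = 1" "dderiv e0 (dderiv e0 u) z = 0"
        using z(1) Ziff[of z] by (auto simp: Z_def)
      define x0 where "x0 = midpoint x1 z"
      define R where "R = dist x1 z / 2"
      have R: "R > 0" "dist z x0 = R" using d by (simp_all add: R_def x0_def dist_midpoint)
      show False
      proof (rule no_interior_tangent_ball[OF assms(1,3,4) eq G psd R _ e0])
        show "z \<in> S" using z(1) by (simp add: Z_def)
        fix y v :: "real ^ 'n"
        assume y: "y \<in> S" "dist y x0 \<le> R" "y \<noteq> z" and v: "norm v = 1"
        \<comment> \<open>The parallelogram law shows that the ball about the midpoint lies strictly inside the ball about \<open>x1\<close>, except for \<open>z\<close>.\<close>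
        have par: "(norm (a + b))\<^sup>2 + (norm (a - b))\<^sup>2 = 2 * (norm a)\<^sup>2 + 2 * (norm b)\<^sup>2"
          for a b :: "real ^ 'n"
          unfolding power2_norm_eq_inner by (simp add: inner_simps inner_commute)
        have mid: "(y - x0) + (z - x0) = y - x1" "(y - x0) - (z - x0) = y - z"
          by (simp_all add: x0_def midpoint_def vec_eq_iff field_simps)
        have "(dist y x1)\<^sup>2 + (dist y z)\<^sup>2 = 2 * (dist y x0)\<^sup>2 + 2 * R\<^sup>2"
          using par[of "y - x0" "z - x0"] unfolding mid R(2)[symmetric] dist_norm .
        moreover have "(dist y x0)\<^sup>2 \<le> R\<^sup>2" using y(2) by (intro power_mono) auto
        moreover have "0 < (dist y z)\<^sup>2" using y(3) by simp
        moreover have "(2 * R)\<^sup>2 = 4 * R\<^sup>2" by simp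
        ultimately have "(dist y x1)\<^sup>2 < (2 * R)\<^sup>2" by linarith
        then have "dist y x1 < 2 * R" by (rule power2_less_imp_less) (use R in simp)
        then have "y \<notin> Z" using nearest[of y] by (auto simp: R_def dist_commute)
        then have "dderiv v (dderiv v u) y \<noteq> 0" using y(1) v Ziff[of y] by (auto simp: Z_def)
        then show "0 < dderiv v (dderiv v u) y" using psd[OF y(1), of v] by simp
      qed
    qed
    then show "\<exists>e>0. ball z1 e \<subseteq> Z" using \<delta>(1) by (intro exI[of _ "\<delta> / 3"]) simp
  qed
  then have "openin (top_of_set S) Z"
    using openin_open_eq[OF assms(1)] by (auto simp: Z_def)
  with closed have "Z = {} \<or> Z = S" using assms(2) connected_clopen by blast
  then show ?thesis using p x by (auto simp: Z_def)
qed

section \<open>An inequality for symmetric third-order tensors\<close>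

text \<open>
Put \<open>s = l k\<close> and let \<open>B\<close>, \<open>P\<close>, \<open>L\<close> be the sums of \<open>b\<close>, \<open>l b\<close>, \<open>l\<close> over the indices other than \<open>k\<close>, so that
\<open>b k = - B\<close>. Cauchy-Schwarz gives \<open>\<Sum> b\<^sup>2 \<ge> B\<^sup>2/(n-1)\<close> and \<open>\<Sum> l b\<^sup>2 \<ge> P\<^sup>2/L\<close> over these indices. With
\<open>n/(n-1) \<le> 2\<close> the claim reduces to \<open>(P - s B)\<^sup>2 \<le> (s + L) (s B\<^sup>2 + P\<^sup>2/L)\<close>, which is Cauchy-Schwarz again.
The constant \<open>n/(n-1)\<close> is forced by large \<open>s\<close>.
\<close>

lemma weighted_sum_inequality:
  fixes b l :: "'n::finite \<Rightarrow> real"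
  assumes n: "2 \<le> CARD('n)" and l: "\<And>i. 0 < l i" and b: "(\<Sum>i\<in>UNIV. b i) = 0"
  shows "real CARD('n) / (real CARD('n) - 1) * (\<Sum>i\<in>UNIV. l i * b i)\<^sup>2
    \<le> (\<Sum>i\<in>UNIV. l i) * ((\<Sum>i\<in>UNIV. l k * (b i)\<^sup>2) + 2 * (\<Sum>i\<in>UNIV - {k}. l i * (b i)\<^sup>2))"
proof -
  let ?U = "UNIV - {k}"
  define s where "s = l k"
  define N where "N = real CARD('n) - 1"
  define B where "B = (\<Sum>i\<in>?U. b i)"
  define P where "P = (\<Sum>i\<in>?U. l i * b i)"
  define Q where "Q = (\<Sum>i\<in>?U. l i * (b i)\<^sup>2)"
  define R where "R = (\<Sum>i\<in>?U. (b i)\<^sup>2)"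
  define L where "L = (\<Sum>i\<in>?U. l i)"
  define c where "c = real CARD('n) / (real CARD('n) - 1)"
  have card: "real (card ?U) = N" using n by (simp add: N_def)
  have N: "1 \<le> N" using n by (simp add: N_def)
  have c: "c = 1 + 1 / N" "0 \<le> c" "c \<le> 2" using N by (auto simp: c_def N_def field_simps)
  have split: "(\<Sum>i\<in>UNIV. f i) = f k + (\<Sum>i\<in>?U. f i)" for f :: "'n \<Rightarrow> real"
    by (simp add: sum.remove)
  have bk: "b k = - B" using b unfolding split B_def by simp
  have "?U \<noteq> {}"
  proof
    assume "?U = {}"
    then have "card ?U = 0" by (simp only: card.empty)
    with card N show False by linarith
  qed
  then have L: "0 < L" unfolding L_def using l by (intro sum_pos) auto
  have s: "0 < s" using l by (simp add: s_def)
  have "B\<^sup>2 \<le> N * R"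
    using Cauchy_Schwarz_ineq_sum[of "\<lambda>_. 1" b ?U] card by (simp add: B_def R_def)
  then have "B\<^sup>2 / N \<le> R" using N by (simp add: field_simps)
  then have "s * (B\<^sup>2 / N) \<le> s * R" using s by (intro mult_left_mono) auto
  then have 1: "c * (s * B\<^sup>2) \<le> s * B\<^sup>2 + s * R" by (simp add: c(1) algebra_simps)
  have "(\<Sum>i\<in>?U. sqrt (l i) * (sqrt (l i) * b i))\<^sup>2 \<le> (\<Sum>i\<in>?U. (sqrt (l i))\<^sup>2) * (\<Sum>i\<in>?U. (sqrt (l i) * b i)\<^sup>2)"
    by (rule Cauchy_Schwarz_ineq_sum)
  then have "P\<^sup>2 \<le> L * Q"
    using l by (simp add: P_def L_def Q_def power_mult_distrib mult.assoc[symmetric] less_imp_le)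
  then have "P\<^sup>2 / L \<le> Q" using L by (simp add: field_simps)
  moreover have "c * (P\<^sup>2 / L) \<le> 2 * (P\<^sup>2 / L)" using c(3) L by (intro mult_right_mono) auto
  ultimately have 2: "c * (P\<^sup>2 / L) \<le> 2 * Q" by linarith
  have "(s + L) * (s * B\<^sup>2 + P\<^sup>2 / L) - (P - s * B)\<^sup>2 = s / L * (P + L * B)\<^sup>2"
    using L by (simp add: field_simps power2_eq_square)
  moreover have "0 \<le> s / L * (P + L * B)\<^sup>2" using s L by simp
  ultimately have "(P - s * B)\<^sup>2 \<le> (s + L) * (s * B\<^sup>2 + P\<^sup>2 / L)" by linarith
  then have "c * (P - s * B)\<^sup>2 \<le> c * ((s + L) * (s * B\<^sup>2 + P\<^sup>2 / L))" using c(2) by (rule mult_left_mono)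
  also have "\<dots> = (s + L) * (c * (s * B\<^sup>2) + c * (P\<^sup>2 / L))" by (simp add: algebra_simps)
  also have "\<dots> \<le> (s + L) * (s * B\<^sup>2 + s * R + 2 * Q)"
    using 1 2 s L by (intro mult_left_mono) auto
  finally have "c * (P - s * B)\<^sup>2 \<le> (s + L) * (s * B\<^sup>2 + s * R + 2 * Q)" .
  moreover have "(\<Sum>i\<in>UNIV. l i * b i) = P - s * B" unfolding split P_def s_def by (simp add: bk)
  moreover have "(\<Sum>i\<in>UNIV. l i) = s + L" unfolding split L_def s_def ..
  moreover have "(\<Sum>i\<in>UNIV. l k * (b i)\<^sup>2) = s * B\<^sup>2 + s * R"
    unfolding split R_def s_def by (simp add: bk sum_distrib_left)
  ultimately show ?thesis by (simp add: c_def Q_def)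
qed

text \<open>
Of the sum on the right only the terms in which two indices coincide are kept. By symmetry, for each \<open>k\<close> these are
the entries \<open>T i i k\<close>, once with weight \<open>1 / l\<^sub>i\<^sup>2\<close> and, for \<open>i \<noteq> k\<close>, twice with weight
\<open>1 / (l\<^sub>i l\<^sub>k)\<close>. The preceding inequality with \<open>b\<^sub>i = T i i k / l\<^sub>i\<close> then applies for each \<open>k\<close>.
\<close>

lemma symmetric_tensor_trace_inequality:
  fixes T :: "'n::finite \<Rightarrow> 'n \<Rightarrow> 'n \<Rightarrow> real" and l :: "'n \<Rightarrow> real"
  assumes n: "2 \<le> CARD('n)" and l: "\<And>i. 0 < l i"
    and sym: "\<And>i j k. T i j k = T j i k" "\<And>i j k. T i j k = T i k j"
    and tr: "\<And>k. (\<Sum>i\<in>UNIV. T i i k / l i) = 0"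
  shows "real CARD('n) / (real CARD('n) - 1) / (\<Sum>i\<in>UNIV. l i) * (\<Sum>k\<in>UNIV. (\<Sum>i\<in>UNIV. T i i k)\<^sup>2 / l k)
    \<le> (\<Sum>k\<in>UNIV. \<Sum>i\<in>UNIV. \<Sum>j\<in>UNIV. (T i j k)\<^sup>2 / (l i * l j))"
proof -
  define f where "f i j k = (T i j k)\<^sup>2 / (l i * l j)" for i j k
  define g where "g i k = (if i = k then 0 else f i k k)" for i k
  define c where "c = real CARD('n) / (real CARD('n) - 1)"
  define \<Lambda> where "\<Lambda> = (\<Sum>i\<in>UNIV. l i)"
  have f0: "0 \<le> f i j k" for i j k using l[of i] l[of j] by (simp add: f_def)
  have fsym: "f i j k = f j i k" for i j k by (simp add: f_def sym(1)[of i j] mult.commute)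
  have \<Lambda>: "0 < \<Lambda>" unfolding \<Lambda>_def using l by (intro sum_pos) auto
  have drop: "(\<Sum>i\<in>UNIV. f i i k) + 2 * (\<Sum>i\<in>UNIV. g i k) \<le> (\<Sum>i\<in>UNIV. \<Sum>j\<in>UNIV. f i j k)" for k
  proof -
    have "(\<Sum>i\<in>UNIV. \<Sum>j\<in>UNIV. (if j = i then f i j k else 0) + (if j = k then g i k else 0)
        + (if i = k then g j k else 0)) \<le> (\<Sum>i\<in>UNIV. \<Sum>j\<in>UNIV. f i j k)"
      by (intro sum_mono) (auto simp: g_def f0 fsym)
    also have "(\<Sum>i\<in>UNIV. \<Sum>j\<in>UNIV. (if j = i then f i j k else 0) + (if j = k then g i k else 0)
        + (if i = k then g j k else 0)) = (\<Sum>i\<in>UNIV. f i i k) + (\<Sum>i\<in>UNIV. g i k)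
        + (\<Sum>i\<in>UNIV. \<Sum>j\<in>UNIV. if i = k then g j k else 0)"
      by (simp add: sum.distrib)
    also have "(\<Sum>i\<in>UNIV. \<Sum>j\<in>UNIV. if i = k then g j k else 0) = (\<Sum>j\<in>UNIV. g j k)"
      by (subst sum.swap) simp
    finally show ?thesis by simp
  qed
  have per_k: "c / \<Lambda> * ((\<Sum>i\<in>UNIV. T i i k)\<^sup>2 / l k) \<le> (\<Sum>i\<in>UNIV. f i i k) + 2 * (\<Sum>i\<in>UNIV. g k i)" for k
  proof -
    define b where "b i = T i i k / l i" for i
    have lb: "l i * b i = T i i k" for i using l[of i] by (simp add: b_def)
    have 1: "f i i k = (b i)\<^sup>2" for i by (simp add: f_def b_def power2_eq_square)
    have 2: "g k i = (if i = k then 0 else l i * (b i)\<^sup>2 / l k)" for i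
      using l[of i] l[of k] by (simp add: g_def f_def b_def power2_eq_square sym(1)[of k i] sym(2)[of i k i])
    have "(\<Sum>i\<in>UNIV - {k}. l i * (b i)\<^sup>2) = (\<Sum>i\<in>UNIV. l k * g k i)"
      using l[of k] by (intro sum.mono_neutral_cong_left) (auto simp: 2)
    also have "\<dots> = l k * (\<Sum>i\<in>UNIV. g k i)" by (simp add: sum_distrib_left)
    finally have off: "(\<Sum>i\<in>UNIV - {k}. l i * (b i)\<^sup>2) = l k * (\<Sum>i\<in>UNIV. g k i)" .
    have "c * (\<Sum>i\<in>UNIV. T i i k)\<^sup>2
        \<le> \<Lambda> * ((\<Sum>i\<in>UNIV. l k * (b i)\<^sup>2) + 2 * (\<Sum>i\<in>UNIV - {k}. l i * (b i)\<^sup>2))"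
      using weighted_sum_inequality[where l = l and b = b and k = k, OF n l] tr[of k]
      unfolding c_def \<Lambda>_def lb by (simp add: b_def)
    also have "\<dots> = \<Lambda> * (l k * ((\<Sum>i\<in>UNIV. f i i k) + 2 * (\<Sum>i\<in>UNIV. g k i)))"
      unfolding off 1 by (simp add: sum_distrib_left[symmetric] distrib_left)
    finally have "c * (\<Sum>i\<in>UNIV. T i i k)\<^sup>2
        \<le> \<Lambda> * (l k * ((\<Sum>i\<in>UNIV. f i i k) + 2 * (\<Sum>i\<in>UNIV. g k i)))" .
    then show ?thesis using \<Lambda> l[of k] by (simp add: field_simps)
  qed
  have "c / \<Lambda> * (\<Sum>k\<in>UNIV. (\<Sum>i\<in>UNIV. T i i k)\<^sup>2 / l k)
      \<le> (\<Sum>k\<in>UNIV. (\<Sum>i\<in>UNIV. f i i k) + 2 * (\<Sum>i\<in>UNIV. g k i))"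
    unfolding sum_distrib_left by (rule sum_mono) (rule per_k[unfolded sum_distrib_left])
  \<comment> \<open>The off-diagonal terms match only after the roles of \<open>i\<close> and \<open>k\<close> are exchanged in the double sum.\<close>
  also have "\<dots> = (\<Sum>k\<in>UNIV. (\<Sum>i\<in>UNIV. f i i k) + 2 * (\<Sum>i\<in>UNIV. g i k))"
    by (simp only: sum.distrib sum_distrib_left[symmetric]) (simp add: sum.swap[of "\<lambda>k i. g k i"])
  also have "\<dots> \<le> (\<Sum>k\<in>UNIV. \<Sum>i\<in>UNIV. \<Sum>j\<in>UNIV. f i j k)"
    by (rule sum_mono) (rule drop)
  finally show ?thesis by (simp add: f_def c_def \<Lambda>_def)
qed

section \<open>Local minima of the Hessian determinant are degenerate\<close>

text \<open>
These are the conditions \<open>(ln det W)\<^sub>a = 0\<close> and \<open>(ln det W)\<^sub>a\<^sub>a \<ge> 0\<close> at a nondegenerate local minimum, in a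
basis \<open>r\<close> that turns the Hessian at \<open>p\<close> into the identity. In that basis the determinant equals \<open>1\<close> at \<open>p\<close> and is
at least \<open>1\<close> nearby.
\<close>

lemma nondegenerate_local_min_third_order:
  fixes u :: "real ^ 'n \<Rightarrow> real" and r :: "'n \<Rightarrow> real ^ 'n"
  assumes "open S" "smooth_on S u" "p \<in> S"
    and psd: "\<And>x v. x \<in> S \<Longrightarrow> 0 \<le> dderiv v (dderiv v u) x"
    and r: "\<And>i j. dderiv (r i) (dderiv (r j) u) p = (if i = j then 1 else 0)"
    and min: "\<forall>\<^sub>F x in nhds p. det (hessian u p) \<le> det (hessian u x)"
  shows "(\<Sum>i\<in>UNIV. dderiv a (dderiv (r i) (dderiv (r i) u)) p) = 0"
    and "(\<Sum>i\<in>UNIV. \<Sum>j\<in>UNIV. (dderiv a (dderiv (r i) (dderiv (r j) u)) p)\<^sup>2)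
      \<le> (\<Sum>i\<in>UNIV. dderiv a (dderiv a (dderiv (r i) (dderiv (r i) u))) p)"
proof -
  note sm = smooth_on_dderiv
  define R :: "real ^ 'n ^ 'n" where "R = (\<chi> i j. r j $ i)"
  have nth: "R $ i $ j = r j $ i" for i j by (simp add: R_def)
  define N where "N x = transpose R ** hessian u x ** R" for x
  have Nnth: "N x $ i $ j = dderiv (r i) (dderiv (r j) u) x" if "x \<in> S" for x i j
    unfolding N_def congruence_nth[OF nth] by (rule inner_hessian[OF assms(1,2) that])
  have detN: "det (N x) = det R * det R * det (hessian u x)" for x
    by (simp add: N_def det_mul mult_ac)
  have "N p = mat 1" by (simp add: vec_eq_iff Nnth[OF assms(3)] r mat_def)
  then have R1: "det R * det R * det (hessian u p) = 1"
    using detN[of p] by simp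
  define E where "E t i j = dderiv (r i) (dderiv (r j) u) (p + t *\<^sub>R a) - (if i = j then 1 else 0)" for t i j
  define E1 where "E1 t i j = dderiv a (dderiv (r i) (dderiv (r j) u)) (p + t *\<^sub>R a)" for t i j
  have E0: "E 0 i j = 0" for i j by (simp add: E_def r)
  have d1: "\<forall>\<^sub>F t in nhds 0. \<forall>i j. ((\<lambda>t. E t i j) has_real_derivative E1 t i j) (at t)"
    using eventually_line_in_open[OF assms(1,3), of a]
  proof eventually_elim
    case (elim t)
    have "((\<lambda>t. E t i j) has_real_derivative E1 t i j - 0) (at t)" for i j
      unfolding E_def E1_def by (intro DERIV_diff DERIV_const dderiv_line[OF sm[OF sm[OF assms(2)]] elim])
    then show ?case by simp
  qed
  have d2: "((\<lambda>t. E1 t i j) has_real_derivative dderiv a (dderiv a (dderiv (r i) (dderiv (r j) u))) p) (at 0)" for i j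
    using dderiv_line[OF sm[OF sm[OF sm[OF assms(2)]]], of p 0 a a "r i" "r j"] assms(3) by (simp add: E1_def)
  obtain U where U: "open U" "p \<in> U" "\<And>x. x \<in> U \<Longrightarrow> det (hessian u p) \<le> det (hessian u x)"
    using min by (auto simp: eventually_nhds)
  have ge: "\<forall>\<^sub>F t in nhds 0. 0 \<le> (\<Sum>i\<in>UNIV. E t i i) - (\<Sum>i\<in>UNIV. \<Sum>j\<in>UNIV. E t i j * E t j i) / 2
      + (\<Sum>i\<in>UNIV. \<Sum>j\<in>UNIV. \<Sum>k\<in>UNIV. E t i j * E t j k * E t k i) / 3"
    using eventually_line_in_open[OF assms(1,3), of a] eventually_line_in_open[OF U(1,2), of a]
  proof eventually_elim
    case (elim t)
    define x where "x = p + t *\<^sub>R a"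
    have x: "x \<in> S" "det (hessian u p) \<le> det (hessian u x)" using elim U(3) by (auto simp: x_def)
    define M where "M = N x - mat 1"
    have M: "M $ i $ j = E t i j" for i j
      by (simp add: M_def E_def Nnth[OF x(1)] mat_def flip: x_def)
    have "0 \<le> trace M - trace (M ** M) / 2 + trace (M ** M ** M) / 3"
      unfolding M_def
    proof (rule det_ge_one_trace_inequality)
      show "transpose (N x) = N x"
        by (simp add: vec_eq_iff transpose_def Nnth[OF x(1)] dderiv_commute[OF assms(1,2) x(1)])
      show "pos_semidef (N x)"
        unfolding pos_semidef_def
      proof
        fix v
        have "v \<bullet> (N x *v v) = (R *v v) \<bullet> (hessian u x *v (R *v v))"
          unfolding N_def matrix_vector_mul_assoc[symmetric]
          by (metis dot_lmul_matrix transpose_matrix_vector inner_commute)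
        then show "0 \<le> v \<bullet> (N x *v v)" by (simp add: inner_hessian[OF assms(1,2) x(1)] psd[OF x(1)])
      qed
      have "det R * det R * det (hessian u p) \<le> det R * det R * det (hessian u x)"
        using x(2) by (intro mult_left_mono) auto
      then show "1 \<le> det (N x)" unfolding R1 detN .
    qed
    also have "trace M = (\<Sum>i\<in>UNIV. E t i i)" by (simp add: trace_def M)
    also have "trace (M ** M) = (\<Sum>i\<in>UNIV. \<Sum>j\<in>UNIV. E t i j * E t j i)"
      by (simp add: trace_def matrix_matrix_mult_def M)
    also have "trace (M ** M ** M) = (\<Sum>i\<in>UNIV. \<Sum>j\<in>UNIV. \<Sum>k\<in>UNIV. E t i j * E t j k * E t k i)"
      unfolding matrix_mul_assoc[symmetric]
      by (simp add: trace_def matrix_matrix_mult_def M sum_distrib_left mult.assoc)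
    finally show ?case .
  qed
  note test = matrix_second_derivative_test[OF E0 d1 d2 ge]
  show "(\<Sum>i\<in>UNIV. dderiv a (dderiv (r i) (dderiv (r i) u)) p) = 0"
    using test(1) by (simp add: E1_def)
  have "E1 0 j i = E1 0 i j" for i j
  proof -
    have "dderiv a (dderiv (r j) (dderiv (r i) u)) p = dderiv a (dderiv (r i) (dderiv (r j) u)) p"
      by (rule dderiv_cong[OF assms(1,3)]) (auto intro: sm assms dderiv_commute)
    then show ?thesis by (simp add: E1_def)
  qed
  then show "(\<Sum>i\<in>UNIV. \<Sum>j\<in>UNIV. (dderiv a (dderiv (r i) (dderiv (r j) u)) p)\<^sup>2)
      \<le> (\<Sum>i\<in>UNIV. dderiv a (dderiv a (dderiv (r i) (dderiv (r i) u))) p)"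
    using test(2) by (simp add: E1_def power2_eq_square)
qed

text \<open>
In an eigenbasis \<open>q\<close> of the Hessian at \<open>p\<close>, the second-order conditions along the directions \<open>q k\<close> add up to
\<open>\<Sum>\<^sub>i\<^sub>j\<^sub>k u\<^sub>i\<^sub>j\<^sub>k\<^sup>2 / (l\<^sub>i l\<^sub>j) \<le> G'' \<Sum>\<^sub>k u\<^sub>k\<^sup>2 / l\<^sub>k + n G'\<close>, whereas the tensor inequality
and the growth condition on \<open>G\<close> bound the left-hand side from below by \<open>G'' \<Sum>\<^sub>k u\<^sub>k\<^sup>2 / l\<^sub>k\<close>.
\<close>

lemma no_nondegenerate_local_min:
  fixes u :: "real ^ 'n \<Rightarrow> real" and G :: "real \<Rightarrow> real"
  assumes n: "2 \<le> CARD('n)" and "open S" "smooth_on S u" "smooth_on UNIV G" "p \<in> S"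
    and eq: "\<And>x. x \<in> S \<Longrightarrow> laplacian u x = G (u x)"
    and G: "G (u p) > 0" "deriv G (u p) < 0"
      "G (u p) * deriv (deriv G) (u p) \<le> real CARD('n) / (real CARD('n) - 1) * (deriv G (u p))\<^sup>2"
    and psd: "\<And>x v. x \<in> S \<Longrightarrow> 0 \<le> dderiv v (dderiv v u) x"
    and nz: "det (hessian u p) \<noteq> 0"
    and min: "\<forall>\<^sub>F x in nhds p. det (hessian u p) \<le> det (hessian u x)"
  shows False
proof -
  note sm = smooth_on_dderiv and inner_H = inner_hessian[OF assms(2,3,5)]
  let ?g = "G (u p)" and ?g' = "deriv G (u p)" and ?g'' = "deriv (deriv G) (u p)"
  define c where "c = real CARD('n) / (real CARD('n) - 1)"
  obtain q :: "'n \<Rightarrow> real ^ 'n" and l where q: "\<And>i j. q i \<bullet> q j = (if i = j then 1 else 0)"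
    and l: "\<And>i. hessian u p *v q i = l i *\<^sub>R q i"
    using symmetric_matrix_eigenbasis[OF hessian_symmetric[OF assms(2,3,5)]] by blast
  have Hq: "dderiv (q i) (dderiv (q j) u) p = (if i = j then l i else 0)" for i j
    by (simp add: inner_H[symmetric] l q)
  have lpos: "0 < l i" for i
  proof -
    have "norm (q i) = 1" by (simp add: norm_eq_1 q)
    then have "dderiv (q i) (dderiv (q i) u) p \<noteq> 0"
      using det_hessian_zero_iff[OF assms(2,3,5) psd[OF assms(5)]] nz by blast
    then show ?thesis using psd[OF assms(5), of "q i"] by (simp add: Hq)
  qed
  \<comment> \<open>Rescaling the eigenvectors makes the Hessian at \<open>p\<close> the identity in the basis \<open>r\<close>, while \<open>q\<close> stays orthonormal and is used for the Laplacian.\<close>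
  define r where "r i = (1 / sqrt (l i)) *\<^sub>R q i" for i
  have lap: "(\<Sum>k\<in>UNIV. dderiv (q k) (dderiv (q k) u) x) = G (u x)" if "x \<in> S" for x
    using sum_second_dderiv_orthonormal[OF assms(2,3) that q] eq[OF that] by simp
  note lap_diff = semilinear_differentiated[OF assms(2-4) lap assms(5)]
  define T where "T i j k = dderiv (q k) (dderiv (q i) (dderiv (q j) u)) p" for i j k
  have rr: "dderiv (r i) (dderiv (r j) u) x = dderiv (q i) (dderiv (q j) u) x / (sqrt (l i) * sqrt (l j))"
    if "x \<in> S" for i j x
    by (simp add: r_def dderiv_dderiv_scale[OF assms(2,3) that] dderiv_scale_left[OF sm[OF assms(3)] that])
  have Hr: "dderiv (r i) (dderiv (r j) u) p = (if i = j then 1 else 0)" for i j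
    using lpos[of j] by (simp add: rr[OF assms(5)] Hq)
  have Tr: "dderiv (q k) (dderiv (r i) (dderiv (r j) u)) p = T i j k / (sqrt (l i) * sqrt (l j))" for i j k
  proof -
    have "dderiv (q k) (dderiv (r i) (dderiv (r j) u)) p
        = dderiv (q k) (\<lambda>x. dderiv (q i) (dderiv (q j) u) x / (sqrt (l i) * sqrt (l j))) p"
      by (rule dderiv_cong[OF assms(2,5)]) (auto intro: sm assms rr)
    also have "\<dots> = T i j k / (sqrt (l i) * sqrt (l j))"
      unfolding T_def
      by (rule dderiv_eqI, intro bounded_linear.has_derivative[OF bounded_linear_divide]
          smooth_on_has_derivative[where S=S] sm assms)
    finally show ?thesis .
  qed
  have sym1: "T i j k = T j i k" for i j k
    unfolding T_def by (rule dderiv_cong[OF assms(2,5)]) (auto intro: sm assms dderiv_commute)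
  have sym13: "T i j k = T k j i" for i j k
    unfolding T_def by (rule dderiv_commute[OF assms(2) sm[OF assms(3)] assms(5)])
  have sym2: "T i j k = T i k j" for i j k
    by (metis sym1 sym13)
  note third = nondegenerate_local_min_third_order[OF assms(2,3,5) psd Hr min]
  have tr0: "(\<Sum>i\<in>UNIV. T i i k / l i) = 0" for k
    using third(1)[of "q k"] lpos by (simp add: Tr less_imp_le)
  have trT: "(\<Sum>i\<in>UNIV. T i i k) = ?g' * dderiv (q k) u p" for k
  proof -
    have "(\<Sum>i\<in>UNIV. T i i k) = (\<Sum>i\<in>UNIV. dderiv (q i) (dderiv (q i) (dderiv (q k) u)) p)"
      by (rule sum.cong[OF refl]) (simp add: T_def dderiv_square_commute[OF assms(2,3,5)])
    then show ?thesis using lap_diff(1)[of "q k"] by simp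
  qed
  define A where "A = (\<Sum>k\<in>UNIV. (dderiv (q k) u p)\<^sup>2 / l k)"
  have A: "0 \<le> A" unfolding A_def using lpos by (intro sum_nonneg) (simp add: less_imp_le)
  have suml: "(\<Sum>i\<in>UNIV. l i) = ?g" using lap[OF assms(5)] by (simp add: Hq)
  have lower: "c / ?g * (?g'\<^sup>2 * A) \<le> (\<Sum>k\<in>UNIV. \<Sum>i\<in>UNIV. \<Sum>j\<in>UNIV. (T i j k)\<^sup>2 / (l i * l j))"
    using symmetric_tensor_trace_inequality[where l = l and T = T, OF n lpos sym1 sym2 tr0]
    unfolding trT suml A_def c_def by (simp add: power_mult_distrib sum_distrib_left mult.assoc)
  have "(\<Sum>i\<in>UNIV. \<Sum>j\<in>UNIV. (T i j k)\<^sup>2 / (l i * l j))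
      \<le> (\<Sum>i\<in>UNIV. dderiv (q k) (dderiv (q k) (dderiv (r i) (dderiv (r i) u))) p)" for k
    using third(2)[of "q k"] lpos by (simp add: Tr power_divide power_mult_distrib less_imp_le)
  then have "(\<Sum>k\<in>UNIV. \<Sum>i\<in>UNIV. \<Sum>j\<in>UNIV. (T i j k)\<^sup>2 / (l i * l j))
      \<le> (\<Sum>k\<in>UNIV. \<Sum>i\<in>UNIV. dderiv (q k) (dderiv (q k) (dderiv (r i) (dderiv (r i) u))) p)"
    by (rule sum_mono)
  also have "\<dots> = (\<Sum>i\<in>UNIV. \<Sum>k\<in>UNIV. dderiv (q k) (dderiv (q k) (dderiv (r i) (dderiv (r i) u))) p)"
    by (rule sum.swap)
  also have "\<dots> = (\<Sum>i\<in>UNIV. ?g'' * (dderiv (r i) u p)\<^sup>2 + ?g')"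
    by (simp add: lap_diff(2) Hr)
  also have "\<dots> = ?g'' * A + real CARD('n) * ?g'"
  proof -
    have "(dderiv (r i) u p)\<^sup>2 = (dderiv (q i) u p)\<^sup>2 / l i" for i
      using lpos[of i] by (simp add: r_def dderiv_scale_left[OF assms(3,5)] power_divide)
    then show ?thesis by (simp add: A_def sum.distrib sum_distrib_left)
  qed
  finally have "c / ?g * (?g'\<^sup>2 * A) \<le> ?g'' * A + real CARD('n) * ?g'" using lower by linarith
  moreover have "?g'' * A \<le> c / ?g * (?g'\<^sup>2 * A)"
  proof -
    have "?g'' \<le> c * ?g'\<^sup>2 / ?g" using G(1,3) unfolding c_def[symmetric] by (simp add: pos_le_divide_eq mult.commute)
    from mult_right_mono[OF this A] show ?thesis by (simp add: mult.assoc)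
  qed
  moreover have "real CARD('n) * ?g' < 0" using G(2) n by (intro mult_pos_neg) auto
  ultimately show False by linarith
qed

section \<open>The determinant of the Hessian vanishes identically\<close>

theorem theorem1p4:
  fixes \<Omega> :: "(real ^ 'n) set" and G :: "real \<Rightarrow> real" and u :: "real ^ 'n \<Rightarrow> real"
  assumes "CARD('n) \<ge> 2"
    and "open \<Omega>" and "connected \<Omega>" and "\<Omega> \<noteq> {}"
    and "smooth_on UNIV G"
    and "smooth_on \<Omega> u"
    and "hessian_convex_on \<Omega> u"
    and "\<forall>x\<in>\<Omega>. laplacian u x = G (u x)"
    and "\<forall>x\<in>\<Omega>. G (u x) > 0"
    and "\<forall>x\<in>\<Omega>. deriv G (u x) < 0"
    and "\<forall>x\<in>\<Omega>. G (u x) * deriv (deriv G) (u x)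
            \<le> real CARD('n) / (real CARD('n) - 1) * (deriv G (u x))\<^sup>2"
    and "\<exists>p. local_min_at \<Omega> (\<lambda>x. det (hessian u x)) p"
  shows "\<forall>x\<in>\<Omega>. det (hessian u x) = 0"
proof -
  obtain p where p: "p \<in> \<Omega>" and ev: "\<forall>\<^sub>F x in at p within \<Omega>. det (hessian u p) \<le> det (hessian u x)"
    using assms(12) by (auto simp: local_min_at_def)
  have psd: "0 \<le> dderiv v (dderiv v u) x" if "x \<in> \<Omega>" for x v
    unfolding inner_hessian[OF assms(2,6) that, symmetric]
    using assms(7) that by (simp add: hessian_convex_on_def pos_semidef_def)
  have min: "\<forall>\<^sub>F x in nhds p. det (hessian u p) \<le> det (hessian u x)"
    using ev at_within_open[OF p assms(2)] eventually_at_filter by (auto simp: eventually_at_filter elim: eventually_mono)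
  have zero: "det (hessian u p) = 0"
    using no_nondegenerate_local_min[OF assms(1,2,6,5) p _ _ _ _ psd _ min] assms(8-11) p by blast
  have c: "real CARD('n) / (real CARD('n) - 1) \<le> 2" using assms(1) by (simp add: field_simps)
  have G2: "G (u x) * deriv (deriv G) (u x) \<le> 2 * (deriv G (u x))\<^sup>2" if "x \<in> \<Omega>" for x
    using assms(11) that mult_right_mono[OF c, of "(deriv G (u x))\<^sup>2"] by fastforce
  show ?thesis
    using degenerate_set_propagates[OF assms(2,3,6,5) _ _ _ G2 psd p zero]
      assms(8-10) laplacian_eq_sum[of u] by auto
qed

end
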